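(* Suppose the feature model and the response model described in the context hold, with limiting quantities $H,G,\rho^2,\sigma^2$. Then for all $\phi\in(0,\infty)$, $$\min_{\phi_s\ge\phi}\mathscr R^{0}_{\infty}(\phi,\phi_s)\;=\;\min_{\lambda\ge 0}\mathscr R^{\lambda}_{\infty}(\phi,\phi)\;=\;\min_{\phi_s\ge\phi,\ \lambda\ge 0}\mathscr R^{\lambda}_{\infty}(\phi,\phi_s).$$ Further, if $\phi_s^*$ is the optimal subsample aspect ratio for ridgeless (the minimizer of $\phi_s\mapsto\mathscr R^0_\infty(\phi,\phi_s)$ over $\phi_s\ge\phi$) and $\lambda^*$ is the optimal ridge regularization with no subsampling (the minimizer of $\lambda\mapsto\mathscr R^\lambda_\infty(\phi,\phi)$ over $\lambda\ge0$), then for any $\theta\in[0,\lambda^*]$, the full ridge ensemble with penalty parameter $\lambda=\lambda^*-\theta$ and subsample aspect ratio $\phi_s=\phi+\theta(\phi_s^*-\phi)/\lambda^*$ also attains the optimal prediction risk, i.e. $\mathscr R^{\lambda}_\infty(\phi,\phi_s)$ equals the common minimum above.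
   Context: Data: $\mathcal D_n=\{(x_j,y_j):j\in[n]\}$ are i.i.d. random vectors in $\mathbb R^p\times\mathbb R$; $X\in\mathbb R^{n\times p}$ has rows $x_j^\top$ and $y\in\mathbb R^n$ has entries $y_j$. Feature model: $X=Z\Sigma^{1/2}$, where $Z\in\mathbb R^{n\times p}$ has i.i.d. entries with mean $0$, variance $1$, and bounded moments of order $4+\delta$ for some $\delta>0$; $\Sigma\in\mathbb R^{p\times p}$ is deterministic and symmetric with eigenvalues uniformly bounded between $r_{\min}>0$ and $r_{\max}<\infty$. Let $\Sigma=\sum_{j=1}^p r_jw_jw_j^\top$ be the eigenvalue decomposition, with $w_j$ normalized. The empirical spectral distribution $H_p(r)=p^{-1}\sum_{i=1}^p\mathbf 1\{r_i\le r\}$ converges weakly, almost surely with respect to $X$, to a deterministic distribution $H$. Response model: $y=X\beta_0+\epsilon$, where $\beta_0\in\mathbb R^p$ is an unknown signal vector with uniformly bounded $\ell_2$-norm and $\lim_{p\to\infty}\|\beta_0\|_2^2=\rho^2$; $\epsilon$ is an unobserved error vector independent of $X$ with mean $0$, variance $\sigma^2$ and bounded moment of order $4+\delta$ for some $\delta>0$. The distribution $G_p(r)=\|\beta_0\|_2^{-2}\sum_{i=1}^p(\beta_0^\top w_i)^2\mathbf 1\{r_i\le r\}$ converges weakly, almost surely with respect to $X$, to a deterministic distribution $G$. Fixed-point quantities: for $\lambda>0$, $\theta>0$, $v(-\lambda;\theta)$ is the unique nonnegative solution of $$v(-\lambda;\theta)^{-1}=\lambda+\theta\int\frac{r}{1+v(-\lambda;\theta)r}\,dH(r).$$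 For $\lambda=0$: $v(0;\theta)=\lim_{\lambda\to0^+}v(-\lambda;\theta)$ if $\theta>1$ and $v(0;\theta)=+\infty$ otherwise. For $\theta=+\infty$, $v(-\lambda;+\infty)=\lim_{\theta\to\infty}v(-\lambda;\theta)=0$. For $\vartheta\le\theta$ set $$\tilde v(-\lambda;\vartheta,\theta)=\frac{\vartheta\int r^2(1+v(-\lambda;\theta)r)^{-2}dH(r)}{v(-\lambda;\theta)^{-2}-\vartheta\int r^2(1+v(-\lambda;\theta)r)^{-2}dH(r)},\qquad \tilde c(-\lambda;\theta)=\int\frac{r}{(1+v(-\lambda;\theta)r)^2}dG(r).$$ Asymptotic risk of the full ridge ensemble with penalty $\lambda\ge0$, data aspect ratio $\phi$ and subsample aspect ratio $\phi_s\in[\phi,\infty]$: $$\mathscr R^\lambda_\infty(\phi,\phi_s)=\sigma^2+\rho^2\bigl(1+\tilde v(-\lambda;\phi,\phi_s)\bigr)\tilde c(-\lambda;\phi_s)+\sigma^2\,\tilde v(-\lambda;\phi,\phi_s).$$ Expressions where $v\in\{0,+\infty\}$ are understood as the corresponding limits. This is the deterministic limit, as $k,n,p\to\infty$, $p/n\to\phi$, $p/k\to\phi_s$, of the squared prediction risk (conditional on $\mathcal D_n$, at an independent test point from the same distribution) of the average, over all $k$-element subsets $I\subseteq[n]$, of the ridge estimators with penalty $\lambda$ fitted on $\{(x_j,y_j):j\in I\}$, namely the minimizers over $\beta\in\mathbb R^p$ of $\sum_{j\in I}(y_j-x_j^\top\beta)^2/k+\lambda\|\beta\|_2^2$ (for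 $\lambda=0$, the ridgeless estimator obtained as $\lambda\to0^+$). When $\phi_s=\phi$ it is the asymptotic risk of the ridge predictor on the full data.
   Formalization: Minima are infima; a minimizing λ is claimed only for ρ≠0 (if ρ=0<σ the infimum over λ is reached only as λ→∞). The path claim holds for all λ*, φ_s* if at least one is the unique minimizer; otherwise each λ* (and, if ρ≠0, each φ_s* ) has a matching partner. *)

theory Defs
  imports "HOL-Probability.Probability"
begin

text \<open>
  The asymptotics are indexed by \<open>m :: nat\<close>, with sample size \<open>n m\<close> and dimension \<open>p m\<close> both tending
  to infinity. As the dimensions vary with \<open>m\<close>, vectors and matrices are functions on \<open>nat\<close>; only the
  values at indices below \<open>n m\<close> and \<open>p m\<close> matter. Thus \<open>X m \<omega> j l\<close> is the \<open>l\<close>-th coordinate of the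
  \<open>j\<close>-th feature vector in the \<open>m\<close>-th data set.
\<close>

section \<open>Data, feature model and response model\<close>

locale iid_data = prob_space M for M :: "'a measure" +
  fixes n p :: "nat \<Rightarrow> nat"
    and X :: "nat \<Rightarrow> 'a \<Rightarrow> nat \<Rightarrow> nat \<Rightarrow> real"
    and y :: "nat \<Rightarrow> 'a \<Rightarrow> nat \<Rightarrow> real"
  assumes n_at_top: "filterlim n at_top sequentially"
    and p_at_top: "filterlim p at_top sequentially"
    and data_indep:
      "\<And>m. indep_vars (\<lambda>_. (\<Pi>\<^sub>M l\<in>{..<p m}. borel) \<Otimes>\<^sub>M borel)
             (\<lambda>j \<omega>. (\<lambda>l\<in>{..<p m}. X m \<omega> j l, y m \<omega> j)) {..<n m}"
    and data_ident:
      "\<And>m i j. i < n m \<Longrightarrow> j < n m \<Longrightarrow>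
         distr M ((\<Pi>\<^sub>M l\<in>{..<p m}. borel) \<Otimes>\<^sub>M borel) (\<lambda>\<omega>. (\<lambda>l\<in>{..<p m}. X m \<omega> i l, y m \<omega> i)) =
         distr M ((\<Pi>\<^sub>M l\<in>{..<p m}. borel) \<Otimes>\<^sub>M borel) (\<lambda>\<omega>. (\<lambda>l\<in>{..<p m}. X m \<omega> j l, y m \<omega> j))"

definition orthonormal_family :: "nat \<Rightarrow> (nat \<Rightarrow> nat \<Rightarrow> real) \<Rightarrow> bool" where
  "orthonormal_family d w \<longleftrightarrow>
     (\<forall>i<d. \<forall>j<d. (\<Sum>l<d. w i l * w j l) = (if i = j then 1 else 0))"

text \<open>\<open>spectral_matrix d r w\<close> is the matrix \<open>\<Sum>k<d. r k * w k * (w k)\<^sup>T\<close>. For an orthonormal family \<open>w\<close> and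
  \<open>r \<ge> 0\<close>, its positive semidefinite square root has the same eigenvectors and the eigenvalues
  \<open>sqrt (r k)\<close>.\<close>

definition spectral_matrix ::
    "nat \<Rightarrow> (nat \<Rightarrow> real) \<Rightarrow> (nat \<Rightarrow> nat \<Rightarrow> real) \<Rightarrow> nat \<Rightarrow> nat \<Rightarrow> real" where
  "spectral_matrix d r w i j = (\<Sum>k<d. r k * w k i * w k j)"

definition spectral_cdf :: "nat \<Rightarrow> (nat \<Rightarrow> real) \<Rightarrow> real \<Rightarrow> real" where
  "spectral_cdf d r x = (\<Sum>i<d. of_bool (r i \<le> x)) / real d"

definition sq_norm :: "nat \<Rightarrow> (nat \<Rightarrow> real) \<Rightarrow> real" where
  "sq_norm d b = (\<Sum>l<d. (b l)\<^sup>2)"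

definition signal_cdf ::
    "nat \<Rightarrow> (nat \<Rightarrow> real) \<Rightarrow> (nat \<Rightarrow> nat \<Rightarrow> real) \<Rightarrow> (nat \<Rightarrow> real) \<Rightarrow> real \<Rightarrow> real" where
  "signal_cdf d r w b x =
     (\<Sum>i<d. (\<Sum>l<d. b l * w i l)\<^sup>2 * of_bool (r i \<le> x)) / sq_norm d b"

text \<open>\<open>r m\<close> and \<open>w m\<close> are the eigenvalues and eigenvectors of the covariance matrix \<open>Sigma m\<close>; its symmetry
  follows from the decomposition. As \<open>Sigma\<close> and the signal vector \<open>beta\<close> below are deterministic, so are
  the distribution functions \<open>H\<^sub>p\<close> and \<open>G\<^sub>p\<close>, and their almost sure weak convergence is plain weak
  convergence. The law of the entries of \<open>Z\<close> and of the noise may change with \<open>m\<close>; the moment bounds are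
  uniform in \<open>m\<close>.\<close>

locale feature_model = prob_space M for M :: "'a measure" +
  fixes n p :: "nat \<Rightarrow> nat"
    and X Z :: "nat \<Rightarrow> 'a \<Rightarrow> nat \<Rightarrow> nat \<Rightarrow> real"
    and Sigma :: "nat \<Rightarrow> nat \<Rightarrow> nat \<Rightarrow> real"
    and r :: "nat \<Rightarrow> nat \<Rightarrow> real"
    and w :: "nat \<Rightarrow> nat \<Rightarrow> nat \<Rightarrow> real"
    and H :: "real measure"
  assumes Z_indep:
      "\<And>m. indep_vars (\<lambda>_. borel) (\<lambda>(j, l) \<omega>. Z m \<omega> j l) ({..<n m} \<times> {..<p m})"
    and Z_ident:
      "\<And>m i k j l. i < n m \<Longrightarrow> k < p m \<Longrightarrow> j < n m \<Longrightarrow> l < p m \<Longrightarrow>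
         distr M borel (\<lambda>\<omega>. Z m \<omega> i k) = distr M borel (\<lambda>\<omega>. Z m \<omega> j l)"
    and Z_moments:
      "\<exists>\<delta>>0. \<exists>B. \<forall>m. \<forall>j<n m. \<forall>l<p m.
         integrable M (\<lambda>\<omega>. \<bar>Z m \<omega> j l\<bar> powr (4 + \<delta>)) \<and>
         expectation (\<lambda>\<omega>. \<bar>Z m \<omega> j l\<bar> powr (4 + \<delta>)) \<le> B"
    and Z_mean: "\<And>m j l. j < n m \<Longrightarrow> l < p m \<Longrightarrow> expectation (\<lambda>\<omega>. Z m \<omega> j l) = 0"
    and Z_variance: "\<And>m j l. j < n m \<Longrightarrow> l < p m \<Longrightarrow> variance (\<lambda>\<omega>. Z m \<omega> j l) = 1"
    and eigenvectors: "\<And>m. orthonormal_family (p m) (w m)"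
    and Sigma_decomposition:
      "\<And>m i j. i < p m \<Longrightarrow> j < p m \<Longrightarrow> Sigma m i j = spectral_matrix (p m) (r m) (w m) i j"
    and eigenvalue_bounds:
      "\<exists>r_min>0. \<exists>r_max. \<forall>m. \<forall>k<p m. r_min \<le> r m k \<and> r m k \<le> r_max"
    and X_eq:
      "\<And>m \<omega> j l. \<omega> \<in> space M \<Longrightarrow> j < n m \<Longrightarrow> l < p m \<Longrightarrow>
         X m \<omega> j l = (\<Sum>i<p m. Z m \<omega> j i * spectral_matrix (p m) (\<lambda>k. sqrt (r m k)) (w m) i l)"
    and H_distribution: "real_distribution H"
    and H_limit: "weak_conv (\<lambda>m. spectral_cdf (p m) (r m)) (cdf H)"

text \<open>The noise entries are identically distributed and mutually independent by \<open>iid_data\<close>, since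
  \<open>eps m \<omega> j\<close> is a function of the \<open>j\<close>-th data point. Independence of the noise vector and \<open>X\<close> is
  independence of the generated sigma-algebras; the library's \<open>indep_var\<close> requires both random variables
  to have the same type.\<close>

locale response_model = prob_space M for M :: "'a measure" +
  fixes n p :: "nat \<Rightarrow> nat"
    and X :: "nat \<Rightarrow> 'a \<Rightarrow> nat \<Rightarrow> nat \<Rightarrow> real"
    and y eps :: "nat \<Rightarrow> 'a \<Rightarrow> nat \<Rightarrow> real"
    and beta :: "nat \<Rightarrow> nat \<Rightarrow> real"
    and r :: "nat \<Rightarrow> nat \<Rightarrow> real"
    and w :: "nat \<Rightarrow> nat \<Rightarrow> nat \<Rightarrow> real"
    and G :: "real measure"
    and \<rho> \<sigma> :: real
  assumes y_eq:
      "\<And>m \<omega> j. \<omega> \<in> space M \<Longrightarrow> j < n m \<Longrightarrow> y m \<omega> j = (\<Sum>l<p m. X m \<omega> j l * beta m l) + eps m \<omega> j"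
    and beta_bounded: "\<exists>C. \<forall>m. sqrt (sq_norm (p m) (beta m)) \<le> C"
    and beta_limit: "(\<lambda>m. sq_norm (p m) (beta m)) \<longlonglongrightarrow> \<rho>\<^sup>2"
    and eps_measurable: "\<And>m j. j < n m \<Longrightarrow> random_variable borel (\<lambda>\<omega>. eps m \<omega> j)"
    and eps_indep_X:
      "\<And>m. indep_set
         (sets (vimage_algebra (space M) (\<lambda>\<omega>. \<lambda>j\<in>{..<n m}. eps m \<omega> j)
            (\<Pi>\<^sub>M j\<in>{..<n m}. borel)))
         (sets (vimage_algebra (space M) (\<lambda>\<omega>. \<lambda>(j, l)\<in>{..<n m} \<times> {..<p m}. X m \<omega> j l)
            (\<Pi>\<^sub>M (j, l)\<in>{..<n m} \<times> {..<p m}. borel)))"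
    and eps_moments:
      "\<exists>\<delta>>0. \<exists>B. \<forall>m. \<forall>j<n m.
         integrable M (\<lambda>\<omega>. \<bar>eps m \<omega> j\<bar> powr (4 + \<delta>)) \<and>
         expectation (\<lambda>\<omega>. \<bar>eps m \<omega> j\<bar> powr (4 + \<delta>)) \<le> B"
    and eps_mean: "\<And>m j. j < n m \<Longrightarrow> expectation (\<lambda>\<omega>. eps m \<omega> j) = 0"
    and eps_variance: "\<And>m j. j < n m \<Longrightarrow> variance (\<lambda>\<omega>. eps m \<omega> j) = \<sigma>\<^sup>2"
    and G_distribution: "real_distribution G"
    and G_limit: "weak_conv (\<lambda>m. signal_cdf (p m) (r m) (w m) (beta m)) (cdf G)"


section \<open>Fixed-point quantities and the asymptotic risk\<close>

text \<open>The convention \<open>inverse 0 = 0\<close> does not make \<open>v = 0\<close> a solution: the right-hand side is then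
  \<open>l + \<theta> * (\<integral>x. x \<partial>H) > 0\<close>.\<close>

definition v_real :: "real measure \<Rightarrow> real \<Rightarrow> real \<Rightarrow> real" where
  "v_real H l \<theta> =
     (THE v. 0 \<le> v \<and> inverse v = l + \<theta> * (\<integral>x. x / (1 + v * x) \<partial>H))"

text \<open>\<open>v_fix H l \<theta>\<close> is \<open>v(-l; \<theta>)\<close> for penalty \<open>l \<ge> 0\<close> and aspect ratio \<open>\<theta> \<in> (0, \<infinity>]\<close>.\<close>

definition v_fix :: "real measure \<Rightarrow> real \<Rightarrow> ereal \<Rightarrow> ereal" where
  "v_fix H l \<theta> =
     (if \<theta> = \<infinity> then 0
      else if 0 < l then ereal (v_real H l (real_of_ereal \<theta>))
      else if 1 < \<theta> then Lim (at_right 0) (\<lambda>l'. ereal (v_real H l' (real_of_ereal \<theta>)))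
      else \<infinity>)"

text \<open>The quantities \<open>v\<close>-tilde and \<open>c\<close>-tilde depend on the penalty and on the second aspect ratio only
  through the value \<open>v\<close> of the fixed point, which is the last argument here.\<close>

definition v_tilde :: "real measure \<Rightarrow> real \<Rightarrow> real \<Rightarrow> real" where
  "v_tilde H \<phi> v =
     (\<phi> * (\<integral>x. x\<^sup>2 / (1 + v * x)\<^sup>2 \<partial>H)) /
     (1 / v\<^sup>2 - \<phi> * (\<integral>x. x\<^sup>2 / (1 + v * x)\<^sup>2 \<partial>H))"

definition c_tilde :: "real measure \<Rightarrow> real \<Rightarrow> real" where
  "c_tilde G v = (\<integral>x. x / (1 + v * x)\<^sup>2 \<partial>G)"

definition risk_expr ::
    "real measure \<Rightarrow> real measure \<Rightarrow> real \<Rightarrow> real \<Rightarrow> real \<Rightarrow> real \<Rightarrow> real" where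
  "risk_expr H G \<rho> \<sigma> \<phi> v =
     \<sigma>\<^sup>2 + \<rho>\<^sup>2 * (1 + v_tilde H \<phi> v) * c_tilde G v + \<sigma>\<^sup>2 * v_tilde H \<phi> v"

text \<open>\<open>risk H G \<rho> \<sigma> l \<phi> \<phi>s\<close> is the asymptotic risk at penalty \<open>l\<close>, data aspect ratio \<open>\<phi>\<close> and subsample
  aspect ratio \<open>\<phi>s\<close>. It is extended-real valued because of the pole at \<open>l = 0\<close>, \<open>\<phi>s = \<phi> = 1\<close>
  (ridgeless regression at the interpolation threshold).\<close>

definition risk ::
    "real measure \<Rightarrow> real measure \<Rightarrow> real \<Rightarrow> real \<Rightarrow> real \<Rightarrow> real \<Rightarrow> ereal \<Rightarrow> ereal" where
  "risk H G \<rho> \<sigma> l \<phi> \<phi>s =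
     (if v_fix H l \<phi>s = 0 then Lim (at_right 0) (\<lambda>v. ereal (risk_expr H G \<rho> \<sigma> \<phi> v))
      else if v_fix H l \<phi>s = \<infinity> then Lim at_top (\<lambda>v. ereal (risk_expr H G \<rho> \<sigma> \<phi> v))
      else ereal (risk_expr H G \<rho> \<sigma> \<phi> (real_of_ereal (v_fix H l \<phi>s))))"

definition opt_subsample ::
    "real measure \<Rightarrow> real measure \<Rightarrow> real \<Rightarrow> real \<Rightarrow> real \<Rightarrow> ereal \<Rightarrow> bool" where
  "opt_subsample H G \<rho> \<sigma> \<phi> = is_arg_min (\<lambda>\<phi>s. risk H G \<rho> \<sigma> 0 \<phi> \<phi>s) (\<lambda>\<phi>s. ereal \<phi> \<le> \<phi>s)"

definition opt_penalty ::
    "real measure \<Rightarrow> real measure \<Rightarrow> real \<Rightarrow> real \<Rightarrow> real \<Rightarrow> real \<Rightarrow> bool" where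
  "opt_penalty H G \<rho> \<sigma> \<phi> = is_arg_min (\<lambda>l. risk H G \<rho> \<sigma> l \<phi> (ereal \<phi>)) (\<lambda>l. 0 \<le> l)"

definition opt_joint ::
    "real measure \<Rightarrow> real measure \<Rightarrow> real \<Rightarrow> real \<Rightarrow> real \<Rightarrow> real \<times> ereal \<Rightarrow> bool" where
  "opt_joint H G \<rho> \<sigma> \<phi> =
     is_arg_min (\<lambda>(l, \<phi>s). risk H G \<rho> \<sigma> l \<phi> \<phi>s) (\<lambda>(l, \<phi>s). 0 \<le> l \<and> ereal \<phi> \<le> \<phi>s)"

definition min_joint_risk ::
    "real measure \<Rightarrow> real measure \<Rightarrow> real \<Rightarrow> real \<Rightarrow> real \<Rightarrow> ereal" where
  "min_joint_risk H G \<rho> \<sigma> \<phi> = (INF (l, \<phi>s)\<in>{0..} \<times> {ereal \<phi>..}. risk H G \<rho> \<sigma> l \<phi> \<phi>s)"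

text \<open>All penalties \<open>ls - \<theta>\<close>, \<open>\<theta> \<in> [0, ls]\<close>, with the matching subsample aspect ratios are optimal. If
  \<open>ls = 0\<close>, then \<open>\<theta> / ls = 0\<close> and the only pair is \<open>(0, \<phi>)\<close>.\<close>

definition optimal_path ::
    "real measure \<Rightarrow> real measure \<Rightarrow> real \<Rightarrow> real \<Rightarrow> real \<Rightarrow> real \<Rightarrow> ereal \<Rightarrow> bool" where
  "optimal_path H G \<rho> \<sigma> \<phi> ls \<phi>ss \<longleftrightarrow>
     (\<forall>\<theta>\<in>{0..ls}. risk H G \<rho> \<sigma> (ls - \<theta>) \<phi> (ereal \<phi> + ereal (\<theta> / ls) * (\<phi>ss - ereal \<phi>))
        = min_joint_risk H G \<rho> \<sigma> \<phi>)"

end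

theory Submission
  imports Defs "HOL-Real_Asymp.Real_Asymp"
begin

text \<open>
  The penalty \<open>l\<close> and the subsample aspect ratio \<open>\<psi>\<close> enter the risk only through the fixed point \<open>v\<close>. With the
  normalized degrees of freedom \<open>df\<^sub>1(v) = \<integral> vx/(1+vx) dH\<close> and \<open>df\<^sub>2(v) = \<integral> (vx/(1+vx))\<^sup>2 dH\<close> the fixed-point
  equation is \<open>v l + \<psi> df\<^sub>1(v) = 1\<close>, which is affine in \<open>(l, \<psi>)\<close>: on a segment whose endpoints share the same
  \<open>v\<close>, the risk is constant. If \<open>v\<^sub>0\<close> is the fixed point at \<open>(0, \<phi>)\<close>, then varying \<open>\<psi> \<ge> \<phi>\<close> at \<open>l = 0\<close>, or varying
  both parameters, yields exactly the values \<open>v \<in> [0, v\<^sub>0]\<close>, and varying \<open>l\<close> at \<open>\<psi> = \<phi>\<close> yields \<open>(0, v\<^sub>0]\<close>. The risk is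
  the quotient \<open>(\<sigma>\<^sup>2 + \<rho>\<^sup>2 c(v)) / (1 - \<phi> df\<^sub>2(v))\<close>, which is continuous on \<open>[0, v\<^sub>0]\<close> (with values in the
  extended reals), so all three minima agree. Near \<open>0\<close> its numerator decreases linearly if \<open>\<rho> \<noteq> 0\<close> while
  \<open>df\<^sub>2(v) = O(v\<^sup>2)\<close>, so then \<open>v = 0\<close> is not optimal and the optimum is attained by a penalty as well.
\<close>

section \<open>Limit laws with bounded positive support\<close>

text \<open>Continuity points of \<open>cdf D\<close> are dense because atoms are countable, and
  weak convergence evaluates \<open>cdf D\<close> there. Above \<open>b\<close> only constancy of
  \<open>F m\<close> is asked, not the value 1: division by a zero dimension or a zero signal norm
  makes the empirical function vanish everywhere.\<close>

lemma weak_conv_support: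
  assumes "real_distribution D" and wc: "weak_conv F (cdf D)"
    and below: "\<And>m x. x < a \<Longrightarrow> F m x = 0" and above: "\<And>m x. b \<le> x \<Longrightarrow> F m x = F m b"
  shows "AE x in D. a \<le> x \<and> x \<le> b"
proof -
  interpret D: real_distribution D by fact
  have "countable {x. \<not> isCont (cdf D) x}"
    using D.countable_atoms unfolding D.isCont_cdf by (simp add: zero_less_measure_iff)
  then have cont: "\<exists>z. x < z \<and> z < y \<and> isCont (cdf D) z" if "x < y" for x y
    using real_interval_avoid_countable_set[OF that] by force
  have zero: "cdf D x = 0" if x: "x < a" for x
  proof -
    obtain z where z: "x < z" "z < a" "isCont (cdf D) z" using cont[OF x] by blast
    have "(\<lambda>m. F m z) \<longlonglongrightarrow> cdf D z" using wc z by (simp add: weak_conv_def)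
    then have "(\<lambda>m::nat. 0) \<longlonglongrightarrow> cdf D z" using below z by simp
    then have "cdf D z = 0" by (simp add: LIMSEQ_const_iff)
    then show ?thesis using D.cdf_nondecreasing[of x z] D.cdf_nonneg[of x] z by linarith
  qed
  have one: "cdf D x = 1" if x: "b < x" for x
  proof -
    obtain z where z: "b < z" "z < x" "isCont (cdf D) z" using cont[OF x] by blast
    \<comment> \<open>Beyond \<open>b\<close> each \<open>F m\<close> is constant, so the limits at
      two continuity points agree. Hence \<open>cdf D z\<close> dominates the whole function and
      must be its limit at infinity, which is 1.\<close>
    have le: "cdf D t \<le> cdf D z" for t
    proof -
      obtain u where u: "max t x < u" "isCont (cdf D) u" using cont[of "max t x" "max t x + 1"] by auto
      have "(\<lambda>m. F m u) \<longlonglongrightarrow> cdf D u" "(\<lambda>m. F m z) \<longlonglongrightarrow> cdf D z"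
        using wc u z by (simp_all add: weak_conv_def)
      moreover have "F m u = F m z" for m using above[of u m] above[of z m] u z by simp
      ultimately have "(\<lambda>m. F m z) \<longlonglongrightarrow> cdf D u" "(\<lambda>m. F m z) \<longlonglongrightarrow> cdf D z" by simp_all
      then have "cdf D u = cdf D z" by (rule LIMSEQ_unique)
      then show ?thesis using D.cdf_nondecreasing[of t u] u by simp
    qed
    have "1 \<le> cdf D z"
      by (rule tendsto_upperbound[OF D.cdf_lim_at_top_prob]) (use le in auto)
    then show ?thesis using D.cdf_nondecreasing[of z x] D.cdf_bounded_prob[of x] z by linarith
  qed
  \<comment> \<open>Atoms at \<open>a\<close> and \<open>b\<close> are allowed: the mass below
    \<open>a\<close> is a left limit, the mass up to \<open>b\<close> comes from right
    continuity.\<close>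
  have "(cdf D \<longlongrightarrow> 0) (at_left a)"
    by (rule tendsto_eventually) (auto simp: eventually_at_filter zero)
  then have "measure D {..<a} = 0"
    using D.cdf_at_left[of a] tendsto_unique trivial_limit_at_left_real by blast
  then have "AE x in D. x \<notin> {..<a}"
    by (intro AE_not_in) (auto simp: null_sets_def D.emeasure_eq_measure)
  have "(cdf D \<longlongrightarrow> 1) (at_right b)"
    by (rule tendsto_eventually) (auto simp: eventually_at_filter one)
  then have "measure D {..b} = 1"
    using D.cdf_is_right_cont[of b] tendsto_unique trivial_limit_at_right_real
    unfolding continuous_within cdf_def2 by blast
  then have "AE x in D. x \<in> {..b}" by (subst D.AE_in_set_eq_1) auto
  with \<open>AE x in D. x \<notin> {..<a}\<close> show ?thesis by eventually_elim auto
qed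

section \<open>Degrees of freedom and the signal term: bounds, continuity, monotonicity\<close>

definition df1 :: "real measure \<Rightarrow> real \<Rightarrow> real" where
  "df1 D v = (\<integral>x. v * x / (1 + v * x) \<partial>D)"

definition df2 :: "real measure \<Rightarrow> real \<Rightarrow> real" where
  "df2 D v = (\<integral>x. (v * x / (1 + v * x))\<^sup>2 \<partial>D)"

locale positive_bounded_law = real_distribution D for D +
  fixes a b :: real
  assumes a_pos: "0 < a" and support: "AE x in D. a \<le> x \<and> x \<le> b"
begin

lemma a_le_b: "a \<le> b"
proof -
  have "AE x in D. a \<le> b" using support by eventually_elim linarith
  then show ?thesis by simp
qed

lemma b_pos: "0 < b"
  using a_pos a_le_b by linarith

lemma one_plus_pos: "0 \<le> v \<Longrightarrow> 0 \<le> x \<Longrightarrow> 0 < 1 + v * (x::real)"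
  by (simp add: add_pos_nonneg)

lemma integrable_on_support:
  assumes [measurable]: "g \<in> borel_measurable borel"
    and "\<And>x. a \<le> x \<Longrightarrow> x \<le> b \<Longrightarrow> \<bar>g x\<bar> \<le> (B::real)"
  shows "integrable D g"
proof (rule integrable_const_bound)
  show "AE x in D. norm (g x) \<le> B" using support by eventually_elim (use assms in auto)
qed simp

lemma integral_mono_on_support:
  assumes "integrable D f" "integrable D g" "\<And>x. a \<le> x \<Longrightarrow> x \<le> b \<Longrightarrow> f x \<le> (g x :: real)"
  shows "(\<integral>x. f x \<partial>D) \<le> (\<integral>x. g x \<partial>D)"
  by (rule integral_mono_AE[OF assms(1,2)]) (use support in eventually_elim, use assms in auto)

lemma integral_lower:
  assumes "integrable D f" "\<And>x. a \<le> x \<Longrightarrow> x \<le> b \<Longrightarrow> (c::real) \<le> f x"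
  shows "c \<le> (\<integral>x. f x \<partial>D)"
  using integral_mono_on_support[of "\<lambda>_. c" f] assms by (simp add: prob_space[unfolded space_eq_univ])

lemma integral_upper:
  assumes "integrable D f" "\<And>x. a \<le> x \<Longrightarrow> x \<le> b \<Longrightarrow> f x \<le> (c::real)"
  shows "(\<integral>x. f x \<partial>D) \<le> c"
  using integral_mono_on_support[of f "\<lambda>_. c"] assms by (simp add: prob_space[unfolded space_eq_univ])

lemma ratio_bounds:
  fixes x v :: real
  assumes "a \<le> x" "x \<le> b" "0 \<le> v"
  shows "0 \<le> v * x" "v * x / (1 + v * x) \<le> 1" "0 \<le> v * x / (1 + v * x)"
    "v * a / (1 + v * a) \<le> v * x / (1 + v * x)" "v * x / (1 + v * x) \<le> v * b / (1 + v * b)"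
    "\<bar>v * x / (1 + v * x)\<bar> \<le> 1" "\<bar>(v * x / (1 + v * x))\<^sup>2\<bar> \<le> 1"
proof -
  have mono: "s / (1 + s) \<le> t / (1 + t)" if "0 \<le> s" "s \<le> t" for s t :: real
    using that by (simp add: divide_le_eq le_divide_eq) (simp add: algebra_simps)
  have x: "0 \<le> x" using assms a_pos by linarith
  then show nn: "0 \<le> v * x" using assms by simp
  then show le1: "v * x / (1 + v * x) \<le> 1" and ge0: "0 \<le> v * x / (1 + v * x)" by simp_all
  then show "\<bar>v * x / (1 + v * x)\<bar> \<le> 1" by linarith
  from le1 ge0 have "(v * x / (1 + v * x))\<^sup>2 \<le> 1" by (intro power_le_one)
  then show "\<bar>(v * x / (1 + v * x))\<^sup>2\<bar> \<le> 1" by simp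
  show "v * a / (1 + v * a) \<le> v * x / (1 + v * x)"
    using assms a_pos by (intro mono) (auto intro: mult_left_mono)
  show "v * x / (1 + v * x) \<le> v * b / (1 + v * b)"
    using assms nn by (intro mono) (auto intro: mult_left_mono)
qed

lemma integrable_df1: "0 \<le> v \<Longrightarrow> integrable D (\<lambda>x. v * x / (1 + v * x))"
  by (rule integrable_on_support[where B = 1]) (simp, rule ratio_bounds)

lemma integrable_df2: "0 \<le> v \<Longrightarrow> integrable D (\<lambda>x. (v * x / (1 + v * x))\<^sup>2)"
  by (rule integrable_on_support[where B = 1]) (simp, rule ratio_bounds)

lemma c_tilde_integrand_bound:
  assumes "0 \<le> v" "a \<le> x" "x \<le> b"
  shows "\<bar>x / (1 + v * x)\<^sup>2\<bar> \<le> b"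
proof -
  have ge: "1 \<le> (1 + v * x)\<^sup>2" using ratio_bounds(1)[of x v] assms by (intro one_le_power) simp
  with assms a_pos have "x * 1 \<le> b * (1 + v * x)\<^sup>2" by (intro mult_mono) auto
  then show ?thesis using assms a_pos ge by (simp add: divide_le_eq)
qed

lemma integrable_c_tilde: "0 \<le> v \<Longrightarrow> integrable D (\<lambda>x. x / (1 + v * x)\<^sup>2)"
  by (rule integrable_on_support[where B = b]) (simp, rule c_tilde_integrand_bound)

text \<open>Dominated convergence along sequences, with the constant \<open>B\<close> as dominating
  function. The domain \<open>{0..}\<close> keeps \<open>1 + v * x\<close> away from its
  zeros.\<close>

lemma continuous_on_integral:
  fixes g :: "real \<Rightarrow> real \<Rightarrow> real"
  assumes [measurable]: "\<And>v. g v \<in> borel_measurable borel"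
    and bound: "\<And>v x. 0 \<le> v \<Longrightarrow> a \<le> x \<Longrightarrow> x \<le> b \<Longrightarrow> \<bar>g v x\<bar> \<le> B"
    and cont: "\<And>x. a \<le> x \<Longrightarrow> x \<le> b \<Longrightarrow> continuous_on {0..} (\<lambda>v. g v x)"
  shows "continuous_on {0..} (\<lambda>v. \<integral>x. g v x \<partial>D)"
  unfolding continuous_on_sequentially comp_def
proof (intro allI ballI impI, elim conjE)
  fix s :: "nat \<Rightarrow> real" and l
  assume s: "\<forall>n. s n \<in> {0..}" and l: "l \<in> {0..}" and lim: "s \<longlonglongrightarrow> l"
  show "(\<lambda>n. \<integral>x. g (s n) x \<partial>D) \<longlonglongrightarrow> (\<integral>x. g l x \<partial>D)"
  proof (rule integral_dominated_convergence[where w = "\<lambda>_. B"])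
    show "AE x in D. (\<lambda>n. g (s n) x) \<longlonglongrightarrow> g l x"
      using support
    proof eventually_elim
      case (elim x)
      then show ?case using cont[of x] s l lim by (auto simp: continuous_on_sequentially comp_def)
    qed
    show "AE x in D. norm (g (s n) x) \<le> B" for n
      using support by eventually_elim (use bound s in auto)
  qed auto
qed

lemma continuous_on_ratio:
  "a \<le> x \<Longrightarrow> continuous_on {0..} (\<lambda>v. v * x / (1 + v * x))"
  using a_pos by (intro continuous_intros ballI) (auto simp: add_nonneg_eq_0_iff)

lemma continuous_on_df1: "continuous_on {0..} (df1 D)"
  unfolding df1_def
  by (rule continuous_on_integral[where B = 1])
    (simp, rule ratio_bounds, simp_all add: continuous_on_ratio)

lemma continuous_on_df2: "continuous_on {0..} (df2 D)"
  unfolding df2_def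
  by (rule continuous_on_integral[where B = 1])
    (simp, rule ratio_bounds, simp_all add: continuous_on_ratio continuous_on_power)

lemma continuous_on_c_tilde: "continuous_on {0..} (c_tilde D)"
  unfolding c_tilde_def
proof (rule continuous_on_integral[where B = b])
  show "\<bar>x / (1 + v * x)\<^sup>2\<bar> \<le> b" if "0 \<le> v" "a \<le> x" "x \<le> b" for v x
    using that by (rule c_tilde_integrand_bound)
next
  fix x assume "a \<le> x"
  then show "continuous_on {0..} (\<lambda>v. x / (1 + v * x)\<^sup>2)"
    using a_pos by (intro continuous_intros) (auto simp: add_nonneg_eq_0_iff)
qed measurable

lemma df1_bounds:
  assumes "0 \<le> v"
  shows "v * a / (1 + v * a) \<le> df1 D v" "df1 D v \<le> v * b / (1 + v * b)"
  unfolding df1_def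
  by (rule integral_lower[OF integrable_df1[OF assms]], rule ratio_bounds(4), use assms in auto)
    (rule integral_upper[OF integrable_df1[OF assms]], rule ratio_bounds(5), use assms in auto)

lemma df1_pos:
  assumes "0 < v" shows "0 < df1 D v"
proof -
  have "0 < v * a / (1 + v * a)" using assms a_pos by (simp add: add_pos_pos)
  then show ?thesis using df1_bounds(1)[of v] assms by linarith
qed

lemma ratio_b_less_1: "0 \<le> v \<Longrightarrow> v * b / (1 + v * b) < 1"
  using one_plus_pos[of v b] b_pos by (simp add: divide_less_eq)

lemma df1_less_1: "0 \<le> v \<Longrightarrow> df1 D v < 1"
  using df1_bounds(2) ratio_b_less_1 by (rule le_less_trans)

text \<open>For the upper bound, one factor of the squared ratio is replaced by its value at
  \<open>b\<close>; the other integrates to \<open>df1 D v\<close>. This yields both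
  \<open>df2 < df1\<close> and the quadratic smallness of \<open>df2\<close> near 0.\<close>

lemma df2_bounds:
  assumes "0 \<le> v"
  shows "(v * a / (1 + v * a))\<^sup>2 \<le> df2 D v" "df2 D v \<le> v * b / (1 + v * b) * df1 D v" 
proof -
  show "(v * a / (1 + v * a))\<^sup>2 \<le> df2 D v"
    unfolding df2_def
    by (rule integral_lower[OF integrable_df2[OF assms]], rule power_mono, rule ratio_bounds(4)) (use assms a_pos in auto)
  have "df2 D v \<le> (\<integral>x. v * b / (1 + v * b) * (v * x / (1 + v * x)) \<partial>D)"
    unfolding df2_def power2_eq_square
  proof (rule integral_mono_on_support)
    show "integrable D (\<lambda>x. v * x / (1 + v * x) * (v * x / (1 + v * x)))"
      using integrable_df2[OF assms] by (simp add: power2_eq_square)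
    show "integrable D (\<lambda>x. v * b / (1 + v * b) * (v * x / (1 + v * x)))"
      by (rule integrable_mult_right[OF integrable_df1[OF assms]])
  qed (use assms in \<open>intro mult_right_mono ratio_bounds; simp\<close>)
  then show "df2 D v \<le> v * b / (1 + v * b) * df1 D v" unfolding df1_def integral_mult_right_zero .
qed

lemma df2_less_df1:
  assumes "0 < v" shows "df2 D v < df1 D v"
proof -
  have "v * b / (1 + v * b) * df1 D v < 1 * df1 D v"
    using assms df1_pos ratio_b_less_1 by (intro mult_strict_right_mono) auto
  then show ?thesis using df2_bounds(2)[of v] assms by simp
qed

text \<open>The integrands differ by \<open>x * (v - u) / ((1 + v * x) * (1 + u * x))\<close>. The
  explicit rate gives strict monotonicity and, later, the speed at which the fixed point converges
  as the penalty vanishes.\<close>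

lemma df1_increase:
  assumes "0 \<le> u" "u \<le> v"
  shows "a * (v - u) / (1 + v * b)\<^sup>2 \<le> df1 D v - df1 D u"
proof -
  have "df1 D v - df1 D u = (\<integral>x. v * x / (1 + v * x) - u * x / (1 + u * x) \<partial>D)"
    unfolding df1_def using assms by (intro Bochner_Integration.integral_diff[symmetric] integrable_df1) auto
  also have "\<dots> \<ge> a * (v - u) / (1 + v * b)\<^sup>2"
  proof (rule integral_lower)
    fix x assume x: "a \<le> x" "x \<le> b"
    have nn: "0 \<le> u * x" "0 \<le> v * x" using ratio_bounds(1) x assms by auto
    have eq: "v * x / (1 + v * x) - u * x / (1 + u * x) = x * (v - u) / ((1 + v * x) * (1 + u * x))"
      using nn by (subst diff_frac_eq) (auto simp: algebra_simps)
    have "u * x \<le> v * b" "v * x \<le> v * b" using x assms a_pos by (auto intro!: mult_mono mult_left_mono)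
    then have "(1 + v * x) * (1 + u * x) \<le> (1 + v * b)\<^sup>2"
      unfolding power2_eq_square using nn by (intro mult_mono) auto
    then show "a * (v - u) / (1 + v * b)\<^sup>2 \<le> v * x / (1 + v * x) - u * x / (1 + u * x)"
      unfolding eq using x assms a_pos nn
      by (intro frac_le mult_right_mono mult_nonneg_nonneg mult_pos_pos add_pos_nonneg) auto
  qed (use assms in \<open>auto intro!: Bochner_Integration.integrable_diff integrable_df1\<close>)
  finally show ?thesis .
qed

lemma df1_strict_mono: "0 \<le> u \<Longrightarrow> u < v \<Longrightarrow> df1 D u < df1 D v"
proof -
  assume *: "0 \<le> u" "u < v"
  then have "0 < a * (v - u) / (1 + v * b)\<^sup>2"
    using a_pos b_pos by (intro divide_pos_pos mult_pos_pos zero_less_power one_plus_pos) auto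
  then show ?thesis using df1_increase[of u v] * by linarith
qed

lemma df1_mono: "0 \<le> u \<Longrightarrow> u \<le> v \<Longrightarrow> df1 D u \<le> df1 D v"
  using df1_strict_mono[of u v] by (cases "u = v") auto

lemma df2_tendsto_1: "(df2 D \<longlongrightarrow> 1) at_top"
proof (rule tendsto_sandwich)
  show "\<forall>\<^sub>F v in at_top. (v * a / (1 + v * a))\<^sup>2 \<le> df2 D v"
    using eventually_ge_at_top[of 0] by eventually_elim (rule df2_bounds)
  show "\<forall>\<^sub>F v in at_top. df2 D v \<le> 1"
    using eventually_gt_at_top[of 0] by eventually_elim (use df2_less_df1 df1_less_1 in \<open>meson less_imp_le less_trans\<close>)
  show "((\<lambda>v. (v * a / (1 + v * a))\<^sup>2) \<longlongrightarrow> 1) at_top"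
    using a_pos by real_asymp
qed simp

lemma c_tilde_nonneg: "0 \<le> v \<Longrightarrow> 0 \<le> c_tilde D v"
  unfolding c_tilde_def using a_pos by (intro integral_lower integrable_c_tilde) auto

lemma c_tilde_upper:
  assumes "0 \<le> v" shows "c_tilde D v \<le> b / (1 + v * a)\<^sup>2"
  unfolding c_tilde_def
proof (rule integral_upper[OF integrable_c_tilde[OF assms]])
  fix x assume x: "a \<le> x" "x \<le> b"
  have "(1 + v * a)\<^sup>2 \<le> (1 + v * x)\<^sup>2" using x assms a_pos by (intro power_mono) (auto intro: mult_left_mono)
  moreover have "0 < (1 + v * a)\<^sup>2" using assms a_pos by (intro zero_less_power add_pos_nonneg) auto
  ultimately show "x / (1 + v * x)\<^sup>2 \<le> b / (1 + v * a)\<^sup>2"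
    using x a_pos by (intro frac_le) auto
qed

text \<open>Since \<open>x - x / (1 + v * x)\<^sup>2\<close> is at least
  \<open>x - x / (1 + v * x) = v * x\<^sup>2 / (1 + v * x)\<close>, the signal term drops at a
  linear rate from \<open>v = 0\<close>.\<close>

lemma c_tilde_decrease:
  assumes "0 \<le> v" shows "v * a\<^sup>2 / (1 + v * b) \<le> c_tilde D 0 - c_tilde D v"
proof -
  have "c_tilde D 0 - c_tilde D v = (\<integral>x. x / (1 + 0 * x)\<^sup>2 - x / (1 + v * x)\<^sup>2 \<partial>D)"
    unfolding c_tilde_def using assms by (intro Bochner_Integration.integral_diff[symmetric] integrable_c_tilde) auto
  also have "\<dots> \<ge> v * a\<^sup>2 / (1 + v * b)"
  proof (rule integral_lower)
    fix x assume x: "a \<le> x" "x \<le> b"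
    have nn: "0 \<le> v * x" using ratio_bounds(1) x assms by auto
    have "v * a\<^sup>2 / (1 + v * b) \<le> v * x\<^sup>2 / (1 + v * x)"
      using x assms a_pos nn by (intro frac_le mult_left_mono power_mono one_plus_pos) (auto intro!: mult_left_mono)
    also have "\<dots> = x - x / (1 + v * x)" using nn by (simp add: eq_diff_eq add_divide_distrib[symmetric] divide_eq_eq) (simp add: algebra_simps power2_eq_square)
    also have "\<dots> \<le> x - x / (1 + v * x)\<^sup>2"
      using nn x a_pos self_le_power[of "1 + v * x" 2] by (intro diff_left_mono frac_le) auto
    finally show "v * a\<^sup>2 / (1 + v * b) \<le> x / (1 + 0 * x)\<^sup>2 - x / (1 + v * x)\<^sup>2" by simp
  qed (intro Bochner_Integration.integrable_diff integrable_c_tilde; use assms in simp)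
  finally show ?thesis .
qed

subsection \<open>The fixed point\<close>

lemma inverse_eq_iff_df1:
  assumes "0 < v"
  shows "inverse v = l + \<theta> * (\<integral>x. x / (1 + v * x) \<partial>D) \<longleftrightarrow> v * l + \<theta> * df1 D v = 1"
proof -
  have "df1 D v = v * (\<integral>x. x / (1 + v * x) \<partial>D)"
    by (simp add: df1_def flip: times_divide_eq_right)
  then have "v * (l + \<theta> * (\<integral>x. x / (1 + v * x) \<partial>D)) = v * l + \<theta> * df1 D v"
    by (simp add: algebra_simps)
  then show ?thesis
    using assms by (metis inverse_unique right_inverse less_numeral_extra(3))
qed

text \<open>The left-hand side of the equation is strictly increasing in the unknown, also at
  penalty 0, because \<theta> is positive and \<open>df1\<close> increases strictly.\<close>

lemma fixed_point_unique:
  assumes "0 \<le> l" "0 < \<theta>" "0 < u" "0 < v"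
    and "u * l + \<theta> * df1 D u = 1" "v * l + \<theta> * df1 D v = 1"
  shows "u = v"
proof -
  have "s * l + \<theta> * df1 D s < t * l + \<theta> * df1 D t" if "0 < s" "s < t" for s t
    using that assms(1,2) by (intro add_le_less_mono mult_right_mono mult_strict_left_mono df1_strict_mono) auto
  then show ?thesis using assms(3-) by (metis less_irrefl linorder_neqE_linordered_idom)
qed

lemma v_real_eqI:
  assumes "0 < l" "0 < \<theta>" "0 < v" "v * l + \<theta> * df1 D v = 1"
  shows "v_real D l \<theta> = v"
  unfolding v_real_def
proof (rule the_equality)
  show "0 \<le> v \<and> inverse v = l + \<theta> * (\<integral>x. x / (1 + v * x) \<partial>D)"
    using assms by (simp add: inverse_eq_iff_df1)
next
  fix u assume u: "0 \<le> u \<and> inverse u = l + \<theta> * (\<integral>x. x / (1 + u * x) \<partial>D)"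
  \<comment> \<open>The candidate \<open>u = 0\<close> has \<open>inverse u = 0\<close> by
    convention and is excluded by a strictly positive right-hand side.\<close>
  have "0 \<le> (\<integral>x. x \<partial>D)"
    using a_pos by (intro integral_lower integrable_on_support[where B = b]) auto
  then have "0 < l + \<theta> * (\<integral>x. x \<partial>D)" using assms by (intro add_pos_nonneg mult_nonneg_nonneg) auto
  then have "u \<noteq> 0" using u by auto
  with u have "0 < u" by simp
  with u show "u = v"
    using assms inverse_eq_iff_df1[of u l \<theta>] by (intro fixed_point_unique[of l \<theta> u v]) auto
qed

text \<open>Intermediate value theorem, starting from the value 0 at \<open>v = 0\<close>. At
  penalty 0 the left-hand side stays below \<theta>, hence the requirement
  \<open>1 < \<theta>\<close> there.\<close>

lemma fixed_point_exists:
  assumes "0 \<le> l" "0 < \<theta>" "0 < l \<or> 1 < \<theta>"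
  shows "\<exists>v>0. v * l + \<theta> * df1 D v = 1"
proof -
  have "\<exists>t\<ge>0. 1 \<le> t * l + \<theta> * df1 D t"
  proof (cases "0 < l")
    case True
    then show ?thesis
      using assms df1_pos[of "1 / l"] by (intro exI[of _ "1 / l"]) (simp add: less_imp_le)
  next
    case False
    then have l: "l = 0" and th: "1 < \<theta>" using assms by auto
    \<comment> \<open>The solution of \<open>t * a / (1 + t * a) = 1 / \<theta>\<close>, whose
      left-hand side bounds \<open>df1 D t\<close> from below.\<close>
    define t where "t = 1 / (a * (\<theta> - 1))"
    have t: "0 < t" "t * a = 1 / (\<theta> - 1)" using th a_pos by (simp_all add: t_def)
    have "1 + t * a = \<theta> / (\<theta> - 1)" unfolding t(2) using th by (simp add: add_divide_eq_iff)
    then have "t * a / (1 + t * a) = 1 / \<theta>" using th t(2) by simp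
    then have "1 / \<theta> \<le> df1 D t" using df1_bounds(1)[of t] t by simp
    then have "1 \<le> \<theta> * df1 D t" using th by (simp add: field_simps)
    then show ?thesis using t l by (intro exI[of _ t]) simp
  qed
  then obtain t where t: "0 \<le> t" "1 \<le> t * l + \<theta> * df1 D t" by blast
  have "continuous_on {0..t} (\<lambda>v. v * l + \<theta> * df1 D v)"
    by (intro continuous_intros continuous_on_subset[OF continuous_on_df1]) auto
  then obtain v where "0 \<le> v" "v * l + \<theta> * df1 D v = 1"
    using IVT'[of "\<lambda>v. v * l + \<theta> * df1 D v" 0 1 t] t by (auto simp: df1_def)
  then show ?thesis by (intro exI[of _ v]) (auto simp: df1_def order_less_le)
qed

text \<open>If \<open>u\<close> is the fixed point at penalty \<open>l\<close>, subtracting the two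
  equations gives \<open>\<theta> * (df1 D v - df1 D u) = u * l\<close>, which is at most
  \<open>v * l\<close>. With \<open>df1_increase\<close> this becomes
  \<open>v - u \<le> K * l\<close>, so \<open>u\<close> is squeezed towards
  \<open>v\<close>.\<close>

lemma tendsto_v_real:
  assumes "1 < \<theta>" "0 < v" "\<theta> * df1 D v = 1"
  shows "((\<lambda>l. v_real D l \<theta>) \<longlongrightarrow> v) (at_right 0)"
proof (rule tendsto_sandwich)
  define K where "K = v * (1 + v * b)\<^sup>2 / (\<theta> * a)"
  have bounds: "v - K * l \<le> v_real D l \<theta> \<and> v_real D l \<theta> \<le> v" if l: "0 < l" for l
  proof -
    obtain u where u: "0 < u" "u * l + \<theta> * df1 D u = 1" using fixed_point_exists[of l \<theta>] assms l by auto
    have u_eq: "v_real D l \<theta> = u" using u l assms by (intro v_real_eqI) auto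
    have "u \<le> v"
    proof (rule ccontr)
      assume "\<not> u \<le> v"
      then have "\<theta> * df1 D v < \<theta> * df1 D u" using assms by (intro mult_strict_left_mono df1_strict_mono) auto
      then show False using u l assms mult_pos_pos[of u l] by linarith
    qed
    have pos: "0 < (1 + v * b)\<^sup>2" using assms b_pos by (intro zero_less_power one_plus_pos) auto
    have "\<theta> * (a * (v - u) / (1 + v * b)\<^sup>2) \<le> \<theta> * (df1 D v - df1 D u)"
      using assms \<open>u \<le> v\<close> u by (intro mult_left_mono df1_increase) auto
    also have "\<dots> = u * l" using u assms by (simp add: algebra_simps)
    also have "\<dots> \<le> v * l" using \<open>u \<le> v\<close> l by simp
    finally have "v - u \<le> K * l"
      using pos a_pos assms by (simp add: K_def field_simps)
    with u_eq \<open>u \<le> v\<close> show ?thesis by simp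
  qed
  show "\<forall>\<^sub>F l in at_right 0. v - K * l \<le> v_real D l \<theta>" "\<forall>\<^sub>F l in at_right 0. v_real D l \<theta> \<le> v"
    using bounds by (auto simp: eventually_at_filter)
  show "((\<lambda>l. v - K * l) \<longlongrightarrow> v) (at_right 0)" by (auto intro!: tendsto_eq_intros)
qed simp

text \<open>One criterion for both the positive-penalty branch and the ridgeless limit. In the
  latter, \<open>df1 D v < 1\<close> forces \<open>1 < \<theta>\<close>, which selects the branch
  defined by \<open>Lim\<close>.\<close>

lemma v_fix_eqI:
  assumes "0 \<le> l" "0 < \<theta>" "0 < v" "v * l + \<theta> * df1 D v = 1"
  shows "v_fix D l (ereal \<theta>) = ereal v"
proof (cases "0 < l")
  case True
  then show ?thesis using assms by (simp add: v_fix_def v_real_eqI)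
next
  case False
  then have l: "l = 0" "\<theta> * df1 D v = 1" using assms by auto
  then have "1 < \<theta>" using assms df1_less_1[of v] mult_strict_left_mono[of "df1 D v" 1 \<theta>] by simp
  then have "((\<lambda>l. ereal (v_real D l \<theta>)) \<longlongrightarrow> ereal v) (at_right 0)"
    using assms l by (intro tendsto_ereal tendsto_v_real) auto
  then show ?thesis using l \<open>1 < \<theta>\<close> by (simp add: v_fix_def tendsto_Lim)
qed

lemma v_fix_cases [consumes 2]:
  assumes "0 \<le> l" "0 < \<theta>"
  obtains (finite) v where "0 < v" "v * l + \<theta> * df1 D v = 1" "v_fix D l (ereal \<theta>) = ereal v"
  | (infinite) "l = 0" "\<theta> \<le> 1" "v_fix D l (ereal \<theta>) = \<infinity>"
proof (cases "0 < l \<or> 1 < \<theta>")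
  case True
  then show ?thesis using fixed_point_exists[of l \<theta>] v_fix_eqI[of l \<theta>] assms finite by blast
next
  case False
  then show ?thesis using assms infinite by (simp add: v_fix_def)
qed

lemma v_fix_infinity: "v_fix D l \<infinity> = 0"
  by (simp add: v_fix_def)

lemma v_fix_pos: "0 \<le> l \<Longrightarrow> 0 < \<theta> \<Longrightarrow> 0 < v_fix D l (ereal \<theta>)"
  by (rule v_fix_cases[of l \<theta>]) auto

text \<open>Monotonicity of \<open>df1\<close> eliminates the fixed point from the comparison. If
  the fixed point is infinite, then \<open>\<theta> \<le> 1\<close> and both sides hold.\<close>

lemma le_v_fix_0_iff:
  assumes "0 < \<theta>" "0 < v"
  shows "ereal v \<le> v_fix D 0 (ereal \<theta>) \<longleftrightarrow> \<theta> * df1 D v \<le> 1"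
  using order_refl assms(1)
proof (cases rule: v_fix_cases)
  case (finite u)
  have "v \<le> u \<longleftrightarrow> df1 D v \<le> df1 D u"
    using df1_mono[of v u] df1_strict_mono[of u v] assms finite(1) by (metis less_imp_le not_le)
  also have "\<dots> \<longleftrightarrow> \<theta> * df1 D v \<le> 1" using finite(2) assms by (metis add_0 mult_le_cancel_left_pos mult_zero_right)
  finally show ?thesis using finite by simp
next
  case infinite
  have "\<theta> * df1 D v \<le> 1 * 1" using infinite assms df1_less_1[of v] df1_pos[of v] by (intro mult_mono) auto
  then show ?thesis using infinite by simp
qed

text \<open>At a fixed \<open>v\<close>, lowering the penalty to 0 and the ratio to \<phi> can only
  lower \<open>v * l + \<psi> * df1 D v\<close>, so \<open>\<phi> * df1 D v \<le> 1\<close> and the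
  comparison criterion applies.\<close>

lemma v_fix_le:
  assumes "0 < \<phi>" "0 \<le> l" "ereal \<phi> \<le> \<phi>s"
  shows "v_fix D l \<phi>s \<le> v_fix D 0 (ereal \<phi>)"
proof (cases \<phi>s)
  case (real \<psi>)
  then have psi: "0 < \<psi>" "\<phi> \<le> \<psi>" using assms by auto
  from assms(2) psi(1) show ?thesis
  proof (cases rule: v_fix_cases)
    case (finite v)
    have "\<phi> * df1 D v \<le> \<psi> * df1 D v" using psi df1_pos[OF finite(1)] by (intro mult_right_mono) auto
    also have "\<dots> \<le> 1" using finite assms mult_nonneg_nonneg[of v l] by linarith
    finally show ?thesis using le_v_fix_0_iff[of \<phi> v] assms finite real by simp
  next
    case infinite
    then show ?thesis using psi assms by (simp add: v_fix_def)
  qed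
next
  case PInf
  then show ?thesis using v_fix_pos[of 0 \<phi>] assms by (simp add: v_fix_infinity less_imp_le)
qed (use assms in auto)

text \<open>At penalty 0 the equation is solved for the ratio, giving \<open>1 / df1 D u\<close>.
  The value 0 comes from the infinite ratio; the value \<infinity> can only occur as the upper end,
  at ratio \<phi>.\<close>

lemma v_fix_subsample_onto:
  assumes "0 < \<phi>" "0 \<le> v" "v \<le> v_fix D 0 (ereal \<phi>)"
  obtains \<phi>s where "ereal \<phi> \<le> \<phi>s" "v_fix D 0 \<phi>s = v"
proof (cases v)
  case (real u)
  show ?thesis
  proof (cases "u = 0")
    case True
    then show ?thesis using that[of \<infinity>] real by (simp add: v_fix_infinity zero_ereal_def)
  next
    case False
    then have u: "0 < u" using assms real by simp
    have "\<phi> \<le> 1 / df1 D u" using le_v_fix_0_iff[of \<phi> u] df1_pos[OF u] assms real u by (simp add: field_simps)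
    moreover have "v_fix D 0 (ereal (1 / df1 D u)) = ereal u"
      using df1_pos[OF u] u by (intro v_fix_eqI) auto
    ultimately show ?thesis using that[of "ereal (1 / df1 D u)"] real by simp
  qed
next
  case PInf
  then show ?thesis using that[of "ereal \<phi>"] assms by simp
qed (use assms in auto)

text \<open>The equation is solved for the penalty; \<open>(1 - \<phi> * df1 D u) / u\<close> is
  nonnegative exactly when \<open>u\<close> does not exceed the ridgeless fixed point. The value 0
  is out of reach of any finite penalty.\<close>

lemma v_fix_penalty_onto:
  assumes "0 < \<phi>" "0 < v" "v \<le> v_fix D 0 (ereal \<phi>)"
  obtains l where "0 \<le> l" "v_fix D l (ereal \<phi>) = v"
proof (cases v)
  case (real u)
  then have u: "0 < u" using assms by simp
  have "v_fix D ((1 - \<phi> * df1 D u) / u) (ereal \<phi>) = ereal u"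
    using u le_v_fix_0_iff[of \<phi> u] assms real by (intro v_fix_eqI) auto
  then show ?thesis using that[of "(1 - \<phi> * df1 D u) / u"] u le_v_fix_0_iff[of \<phi> u] assms real by simp
next
  case PInf
  then show ?thesis using that[of 0] assms by simp
qed (use assms in auto)

text \<open>The common \<open>v\<close> satisfies the equation at both endpoints, hence at every
  convex combination of them.\<close>

lemma v_fix_path:
  assumes "0 < \<phi>" "0 < ls" "ereal \<phi> \<le> \<phi>s" and eq: "v_fix D ls (ereal \<phi>) = v_fix D 0 \<phi>s"
    and \<theta>: "0 \<le> \<theta>" "\<theta> \<le> ls"
  shows "v_fix D (ls - \<theta>) (ereal \<phi> + ereal (\<theta> / ls) * (\<phi>s - ereal \<phi>)) = v_fix D 0 \<phi>s"
proof -
  from assms have nn: "0 \<le> ls" by simp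
  obtain v where v: "0 < v" "v * ls + \<phi> * df1 D v = 1" "v_fix D ls (ereal \<phi>) = ereal v"
    by (rule v_fix_cases[OF nn assms(1)]) (use assms in auto)
  \<comment> \<open>A positive penalty makes \<open>v\<close> finite and nonzero, which excludes the
    infinite ratio and leaves real arithmetic.\<close>
  then have "\<phi>s \<noteq> \<infinity>" using eq by (auto simp: v_fix_infinity zero_ereal_def)
  then obtain \<psi> where psi: "\<phi>s = ereal \<psi>" "\<phi> \<le> \<psi>" using assms by (cases \<phi>s) auto
  have "\<psi> * df1 D v = 1"
    by (rule v_fix_cases[of 0 \<psi>]) (use psi assms v eq in auto)
  with v(2) have "v * ls = (\<psi> - \<phi>) * df1 D v" by (simp add: algebra_simps)
  moreover have "v * \<theta> = \<theta> / ls * (v * ls)" using assms by simp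
  ultimately have "v * \<theta> = \<theta> / ls * (\<psi> - \<phi>) * df1 D v" by simp
  then have "v * (ls - \<theta>) + (\<phi> + \<theta> / ls * (\<psi> - \<phi>)) * df1 D v = 1"
    using v(2) by (simp add: algebra_simps)
  moreover have "0 < \<phi> + \<theta> / ls * (\<psi> - \<phi>)" using assms psi by (intro add_pos_nonneg) auto
  ultimately have "v_fix D (ls - \<theta>) (ereal (\<phi> + \<theta> / ls * (\<psi> - \<phi>))) = ereal v"
    using v \<theta> by (intro v_fix_eqI) auto
  then show ?thesis using psi v eq by simp
qed

end

section \<open>The risk as a function of the fixed point\<close>

text \<open>Expresses each kind of optimality through an infimum, so that minimizers of different
  problems with equal infima can be compared.\<close>

lemma is_arg_min_iff_eq_INF:
  fixes f :: "'a \<Rightarrow> 'b :: complete_linorder"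
  shows "is_arg_min f P x \<longleftrightarrow> P x \<and> f x = (INF y\<in>Collect P. f y)"
proof
  assume "is_arg_min f P x"
  then have "P x" "\<And>y. P y \<Longrightarrow> f x \<le> f y" by (auto simp: is_arg_min_def not_less)
  then show "P x \<and> f x = (INF y\<in>Collect P. f y)"
    by (auto intro!: antisym INF_greatest INF_lower)
next
  assume "P x \<and> f x = (INF y\<in>Collect P. f y)"
  then show "is_arg_min f P x"
    by (auto simp: is_arg_min_def not_less intro!: INF_lower)
qed

definition risk_at :: "real measure \<Rightarrow> real measure \<Rightarrow> real \<Rightarrow> real \<Rightarrow> real \<Rightarrow> ereal \<Rightarrow> ereal" where
  "risk_at H G \<rho> \<sigma> \<phi> v =
     (if v = 0 then Lim (at_right 0) (\<lambda>v. ereal (risk_expr H G \<rho> \<sigma> \<phi> v))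
      else if v = \<infinity> then Lim at_top (\<lambda>v. ereal (risk_expr H G \<rho> \<sigma> \<phi> v))
      else ereal (risk_expr H G \<rho> \<sigma> \<phi> (real_of_ereal v)))"

lemma risk_eq_risk_at: "risk H G \<rho> \<sigma> l \<phi> \<phi>s = risk_at H G \<rho> \<sigma> \<phi> (v_fix H l \<phi>s)"
  by (simp add: risk_def risk_at_def)

lemma risk_at_pos_real: "0 < v \<Longrightarrow> risk_at H G \<rho> \<sigma> \<phi> (ereal v) = ereal (risk_expr H G \<rho> \<sigma> \<phi> v)"
  by (simp add: risk_at_def)

lemma risk_at_zero_params: "risk_at H G 0 0 \<phi> v = 0"
  by (simp add: risk_at_def risk_expr_def tendsto_Lim zero_ereal_def)

definition risk_quotient :: "real measure \<Rightarrow> real measure \<Rightarrow> real \<Rightarrow> real \<Rightarrow> real \<Rightarrow> real \<Rightarrow> real" where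
  "risk_quotient H G \<rho> \<sigma> \<phi> v = (\<sigma>\<^sup>2 + \<rho>\<^sup>2 * c_tilde G v) / (1 - \<phi> * df2 H v)"

text \<open>The risk factors as \<open>(\<sigma>\<^sup>2 + \<rho>\<^sup>2 * c_tilde G v) * (1 +
  v_tilde H \<phi> v)\<close>. Multiplying numerator and denominator of \<open>v_tilde\<close> by
  \<open>v\<^sup>2\<close> turns the second factor into \<open>1 / (1 - \<phi> * df2 H v)\<close>,
  which also makes sense at \<open>v = 0\<close>.\<close>

lemma risk_expr_eq_quotient:
  assumes "0 < v" "\<phi> * df2 H v < 1"
  shows "risk_expr H G \<rho> \<sigma> \<phi> v = risk_quotient H G \<rho> \<sigma> \<phi> v"
proof -
  define I where "I = (\<integral>x. x\<^sup>2 / (1 + v * x)\<^sup>2 \<partial>H)"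
  have "df2 H v = v\<^sup>2 * I"
    unfolding df2_def I_def power_divide power_mult_distrib times_divide_eq_right[symmetric]
    by (rule integral_mult_right_zero)
  then have I: "I = df2 H v / v\<^sup>2" using assms by simp
  have "1 / v\<^sup>2 - \<phi> * I = (1 - \<phi> * df2 H v) / v\<^sup>2" by (simp add: I diff_divide_distrib)
  then have "v_tilde H \<phi> v = \<phi> * df2 H v / (1 - \<phi> * df2 H v)"
    using assms by (simp add: v_tilde_def flip: I_def) (simp add: I)
  then have vt: "1 + v_tilde H \<phi> v = 1 / (1 - \<phi> * df2 H v)"
    using assms by (simp add: add_divide_eq_iff)
  have "risk_expr H G \<rho> \<sigma> \<phi> v = (\<sigma>\<^sup>2 + \<rho>\<^sup>2 * c_tilde G v) * (1 + v_tilde H \<phi> v)"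
    by (simp add: risk_expr_def algebra_simps)
  then show ?thesis by (simp add: vt risk_quotient_def)
qed

section \<open>Continuity of the risk on the range of the fixed point\<close>

locale risk_limits =
  H: positive_bounded_law H a b + G: positive_bounded_law G a b for H G a b +
  fixes \<rho> \<sigma> \<phi> :: real
  assumes \<phi>_pos: "0 < \<phi>"
begin

abbreviation v_max :: ereal where "v_max \<equiv> v_fix H 0 (ereal \<phi>)"
abbreviation R :: "ereal \<Rightarrow> ereal" where "R \<equiv> risk_at H G \<rho> \<sigma> \<phi>"
abbreviation f :: "real \<Rightarrow> real" where "f \<equiv> risk_quotient H G \<rho> \<sigma> \<phi>"

text \<open>Positivity of the denominator on the whole real range:
  \<open>\<phi> * df2 < \<phi> * df1 \<le> 1\<close> for positive \<open>v\<close>, the last step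
  being \<open>v \<le> v_max\<close>.\<close>

lemma df2_less: "0 \<le> v \<Longrightarrow> ereal v \<le> v_max \<Longrightarrow> \<phi> * df2 H v < 1"
proof -
  assume v: "0 \<le> v" "ereal v \<le> v_max"
  show ?thesis
  proof (cases "v = 0")
    case True
    then show ?thesis by (simp add: df2_def)
  next
    case False
    then have "\<phi> * df2 H v < \<phi> * df1 H v"
      using v \<phi>_pos by (intro mult_strict_left_mono H.df2_less_df1) auto
    also have "\<dots> \<le> 1" using H.le_v_fix_0_iff[of \<phi> v] \<phi>_pos v False by auto
    finally show ?thesis .
  qed
qed

lemma tendsto_risk_expr:
  assumes "0 \<le> v" "\<phi> * df2 H v < 1"
  shows "(risk_expr H G \<rho> \<sigma> \<phi> \<longlongrightarrow> f v) (at v within {0..})"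
proof -
  have df2: "((\<lambda>v. \<phi> * df2 H v) \<longlongrightarrow> \<phi> * df2 H v) (at v within {0..})"
    and c: "(c_tilde G \<longlongrightarrow> c_tilde G v) (at v within {0..})"
    using assms H.continuous_on_df2 G.continuous_on_c_tilde
    by (auto simp: continuous_on_def intro!: tendsto_intros)
  have "(f \<longlongrightarrow> f v) (at v within {0..})"
    unfolding risk_quotient_def using assms by (intro tendsto_intros df2 c) auto
  moreover have "\<forall>\<^sub>F u in at v within {0..}. risk_expr H G \<rho> \<sigma> \<phi> u = f u"
  proof (cases "v = 0")
    case True
    have "\<forall>\<^sub>F u in at v within {0..}. 0 < u" unfolding True by (auto simp: eventually_at_filter)
    with order_tendstoD(2)[OF df2 assms(2)] show ?thesis
      by eventually_elim (rule risk_expr_eq_quotient)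
  next
    case False
    then have "\<forall>\<^sub>F u in at v within {0..}. 0 < u"
      using assms order_tendstoD(1)[OF tendsto_ident_at, of 0 v "{0..}"] by simp
    with order_tendstoD(2)[OF df2 assms(2)] show ?thesis
      by eventually_elim (rule risk_expr_eq_quotient)
  qed
  ultimately show ?thesis by (subst tendsto_cong)
qed

lemma tendsto_risk_expr_at_right_0: "((\<lambda>v. ereal (risk_expr H G \<rho> \<sigma> \<phi> v)) \<longlongrightarrow> ereal (f 0)) (at_right 0)"
proof -
  have "(risk_expr H G \<rho> \<sigma> \<phi> \<longlongrightarrow> f 0) (at_right 0)"
    by (rule tendsto_within_subset[OF tendsto_risk_expr]) (auto simp: df2_def)
  then show ?thesis by (intro tendsto_ereal)
qed

lemma risk_at_real:
  assumes "0 \<le> v" "ereal v \<le> v_max" shows "R (ereal v) = ereal (f v)"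
proof (cases "v = 0")
  case True
  then show ?thesis
    using tendsto_risk_expr_at_right_0 by (simp add: risk_at_def tendsto_Lim zero_ereal_def[symmetric])
next
  case False
  then show ?thesis using assms df2_less by (simp add: risk_at_pos_real risk_expr_eq_quotient)
qed

lemma c_tilde_tendsto_0: "(c_tilde G \<longlongrightarrow> 0) at_top"
proof (rule tendsto_sandwich[OF _ _ tendsto_const])
  show "\<forall>\<^sub>F v in at_top. 0 \<le> c_tilde G v" "\<forall>\<^sub>F v in at_top. c_tilde G v \<le> b / (1 + v * a)\<^sup>2"
    using eventually_ge_at_top[of 0]
    by (eventually_elim, simp add: G.c_tilde_nonneg G.c_tilde_upper)+
  show "((\<lambda>v. b / (1 + v * a)\<^sup>2) \<longlongrightarrow> 0) at_top" using H.a_pos by real_asymp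
qed

text \<open>As \<open>v\<close> grows, \<open>c_tilde\<close> tends to 0 and \<open>df2\<close> to
  1. At \<open>\<phi> = 1\<close> the denominator vanishes in the limit: for
  \<open>\<sigma> = 0\<close> it is at least \<open>1 / (1 + v * b)\<close> and loses against a
  numerator of order at most \<open>1 / v\<^sup>2\<close>, whereas noise produces a pole.\<close>

lemma tendsto_risk_expr_at_top:
  assumes "\<phi> \<le> 1"
  shows "((\<lambda>v. ereal (risk_expr H G \<rho> \<sigma> \<phi> v)) \<longlongrightarrow>
     (if \<phi> < 1 then ereal (\<sigma>\<^sup>2 / (1 - \<phi>)) else if \<sigma> = 0 then 0 else \<infinity>)) at_top" (is "(_ \<longlongrightarrow> ?L) _")
proof -
  have less: "\<phi> * df2 H v < 1" if "0 < v" for v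
  proof -
    have "\<phi> * df2 H v \<le> 1 * df2 H v"
      using assms H.df2_bounds(1)[of v] that by (intro mult_right_mono) (auto intro: order_trans[OF zero_le_power2])
    then show ?thesis using H.df2_less_df1[of v] H.df1_less_1[of v] that by linarith
  qed
  have "\<forall>\<^sub>F v in at_top. ereal (risk_expr H G \<rho> \<sigma> \<phi> v) = ereal (f v)"
    using eventually_gt_at_top[of 0] by eventually_elim (simp add: less risk_expr_eq_quotient)
  moreover have "((\<lambda>v. ereal (f v)) \<longlongrightarrow> ?L) at_top"
  proof -
    consider "\<phi> < 1" | "\<phi> = 1" "\<sigma> = 0" | "\<phi> = 1" "\<sigma> \<noteq> 0" using assms by linarith
    then show ?thesis
    proof cases
      case 1
      have "(f \<longlongrightarrow> (\<sigma>\<^sup>2 + \<rho>\<^sup>2 * 0) / (1 - \<phi> * 1)) at_top"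
        unfolding risk_quotient_def using 1 by (intro tendsto_intros c_tilde_tendsto_0 H.df2_tendsto_1) auto
      then show ?thesis using 1 by (auto intro: tendsto_ereal)
    next
      case 2
      have "(f \<longlongrightarrow> 0) at_top"
      proof (rule tendsto_sandwich[OF _ _ tendsto_const])
        show "\<forall>\<^sub>F v in at_top. 0 \<le> f v"
          using eventually_gt_at_top[of 0]
        proof eventually_elim
          case (elim v)
          then show ?case using less[of v] G.c_tilde_nonneg[of v] by (simp add: risk_quotient_def)
        qed
        show "\<forall>\<^sub>F v in at_top. f v \<le> \<rho>\<^sup>2 * (b / (1 + v * a)\<^sup>2) / (1 / (1 + v * b))"
          using eventually_gt_at_top[of 0]
        proof eventually_elim
          case (elim v)
          have pos: "0 < 1 + v * b" using elim H.b_pos by (intro H.one_plus_pos) auto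
          have "1 / (1 + v * b) = 1 - v * b / (1 + v * b)" using pos by (simp add: diff_divide_eq_iff)
          also have "\<dots> \<le> 1 - \<phi> * df2 H v"
            using H.df2_less_df1[of v] H.df1_bounds(2)[of v] elim 2 by simp
          finally show ?case
            unfolding risk_quotient_def
            using 2 elim pos G.c_tilde_nonneg[of v] mult_left_mono[OF G.c_tilde_upper[of v], of "\<rho>\<^sup>2"]
H.b_pos
            by (intro frac_le) auto
        qed
        show "((\<lambda>v. \<rho>\<^sup>2 * (b / (1 + v * a)\<^sup>2) / (1 / (1 + v * b))) \<longlongrightarrow> 0) at_top"
          using H.a_pos H.b_pos by real_asymp
      qed
      then show ?thesis using 2 by (auto simp: zero_ereal_def intro: tendsto_ereal)
    next
      case 3
      have "filterlim f at_top at_top"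
      proof (rule filterlim_at_top_mono)
        have "filterlim (\<lambda>v. 1 - \<phi> * df2 H v) (at_right 0) at_top"
          unfolding filterlim_at
        proof
          show "((\<lambda>v. 1 - \<phi> * df2 H v) \<longlongrightarrow> 0) at_top"
            using 3 by (auto intro!: tendsto_eq_intros H.df2_tendsto_1)
          show "\<forall>\<^sub>F v in at_top. 1 - \<phi> * df2 H v \<in> {0<..} \<and> 1 - \<phi> * df2 H v \<noteq> 0"
            using eventually_gt_at_top[of 0] by eventually_elim (use less in force)
        qed
        then show "filterlim (\<lambda>v. \<sigma>\<^sup>2 * inverse (1 - \<phi> * df2 H v)) at_top at_top"
          using 3 by (intro filterlim_tendsto_pos_mult_at_top[OF tendsto_const]
              filterlim_compose[OF filterlim_inverse_at_top_right]) auto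
        show "\<forall>\<^sub>F v in at_top. \<sigma>\<^sup>2 * inverse (1 - \<phi> * df2 H v) \<le> f v"
          using eventually_gt_at_top[of 0]
        proof eventually_elim
          case (elim v)
          then show ?case using less[of v] G.c_tilde_nonneg[of v]
            by (simp add: risk_quotient_def divide_inverse mult_right_mono)
        qed
      qed
      then show ?thesis using 3 by (simp add: tendsto_PInfty_eq_at_top)
    qed
  qed
  ultimately show ?thesis by (subst tendsto_cong)
qed

lemma risk_at_infinity:
  "\<phi> \<le> 1 \<Longrightarrow> R \<infinity> = (if \<phi> < 1 then ereal (\<sigma>\<^sup>2 / (1 - \<phi>)) else if \<sigma> = 0 then 0 else \<infinity>)"
  using tendsto_Lim[OF _ tendsto_risk_expr_at_top] by (simp add: risk_at_def)

lemma v_max_pos: "0 < v_max"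
  using H.v_fix_pos \<phi>_pos by simp

lemma v_max_infinite: "v_max = \<infinity> \<Longrightarrow> \<phi> \<le> 1"
  using order_refl \<phi>_pos by (cases rule: H.v_fix_cases) auto

lemma tendsto_risk_at_0: "(R \<longlongrightarrow> R 0) (at_right 0)"
proof -
  have "((\<lambda>v. R (ereal v)) \<longlongrightarrow> ereal (f 0)) (at_right 0)"
    using tendsto_risk_expr_at_right_0
    by (rule Lim_transform_eventually) (auto simp: eventually_at_filter risk_at_pos_real)
  then have "(R \<longlongrightarrow> ereal (f 0)) (at_right (ereal 0))"
    by (simp add: at_right_ereal filterlim_filtermap)
  then show ?thesis using risk_at_real[of 0] v_max_pos by (simp add: zero_ereal_def[symmetric])
qed

text \<open>The values at 0 and \<infinity> are limits by definition. Including both ends makes the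
  domain compact, so a minimum exists even if \<open>v_max\<close> is infinite or the risk has a
  pole there.\<close>

lemma continuous_on_risk_at: "continuous_on {0..v_max} R"
  unfolding continuous_on_def
proof
  fix v assume v: "v \<in> {0..v_max}"
  show "(R \<longlongrightarrow> R v) (at v within {0..v_max})"
  proof (cases v)
    case (real u)
    show ?thesis
    proof (cases "u = 0")
      case True
      then show ?thesis using real tendsto_risk_at_0 v_max_pos by (simp add: at_within_Icc_at_right zero_ereal_def[symmetric])
    next
      case False
      then have u: "0 < u" "ereal u \<le> v_max" using v real by auto
      then have "(risk_expr H G \<rho> \<sigma> \<phi> \<longlongrightarrow> f u) (at u within {0..})"
        by (intro tendsto_risk_expr df2_less) auto
      moreover have "at u within {0..} = at u" using u by (intro at_within_interior) simp
      ultimately have "((\<lambda>v. ereal (risk_expr H G \<rho> \<sigma> \<phi> v)) \<longlongrightarrow> ereal (f u)) (at u)"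
        by (intro tendsto_ereal) simp
      moreover have "\<forall>\<^sub>F v in at u. ereal (risk_expr H G \<rho> \<sigma> \<phi> v) = R (ereal v)"
        using order_tendstoD(1)[OF tendsto_ident_at u(1)] by eventually_elim (simp add: risk_at_pos_real)
      ultimately have "((\<lambda>v. R (ereal v)) \<longlongrightarrow> ereal (f u)) (at u)"
        by (rule Lim_transform_eventually)
      then have "(R \<longlongrightarrow> R v) (at v)"
        using real u by (simp add: at_ereal filterlim_filtermap risk_at_real)
      then show ?thesis by (rule tendsto_within_subset) simp
    qed
  next
    case PInf
    then have "\<phi> \<le> 1" using v v_max_infinite by simp
    have "((\<lambda>v. R (ereal v)) \<longlongrightarrow> R \<infinity>) at_top"
      unfolding risk_at_infinity[OF \<open>\<phi> \<le> 1\<close>]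
      by (rule Lim_transform_eventually[OF tendsto_risk_expr_at_top[OF \<open>\<phi> \<le> 1\<close>]])
        (use eventually_gt_at_top[of 0] in eventually_elim, simp add: risk_at_pos_real)
    then have "(R \<longlongrightarrow> R \<infinity>) (at \<infinity>)"
      by (simp add: at_infty_ereal_eq_at_top filterlim_filtermap)
    then show ?thesis unfolding PInf by (rule tendsto_within_subset) simp
  qed (use v in auto)
qed

section \<open>The minimum over the fixed point and the role of the value 0\<close>

abbreviation min_risk :: ereal where "min_risk \<equiv> INF v\<in>{0..v_max}. R v"

lemma min_risk_attained: "\<exists>v\<in>{0..v_max}. R v = min_risk"
proof -
  have "compact {0..v_max}" by (simp add: compact_eq_closed)
  moreover have "{0..v_max} \<noteq> {}" using v_max_pos by auto
  ultimately obtain v where "v \<in> {0..v_max}" "\<And>u. u \<in> {0..v_max} \<Longrightarrow> R v \<le> R u"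
    using continuous_attains_inf continuous_on_risk_at by metis
  then show ?thesis by (intro bexI[of _ v] antisym INF_greatest INF_lower)
qed

text \<open>Penalties reach only positive \<open>v\<close>. Since \<open>R 0\<close> is a limit of
  values at positive \<open>v\<close>, leaving out 0 keeps the infimum, though possibly not its
  attainment.\<close>

lemma INF_positive: "(INF v\<in>{0<..v_max}. R v) = min_risk"
proof (rule antisym)
  show "min_risk \<le> (INF v\<in>{0<..v_max}. R v)" by (rule INF_superset_mono) auto
  show "(INF v\<in>{0<..v_max}. R v) \<le> min_risk"
  proof (rule INF_greatest)
    fix v assume v: "v \<in> {0..v_max}"
    have "(INF v\<in>{0<..v_max}. R v) \<le> R 0"
    proof (rule tendsto_lowerbound[OF tendsto_risk_at_0])
      show "\<forall>\<^sub>F v in at_right 0. (INF v\<in>{0<..v_max}. R v) \<le> R v"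
        by (intro eventually_at_rightI[OF _ v_max_pos] INF_lower) auto
      show "at_right (0::ereal) \<noteq> bot"
        by (simp add: zero_ereal_def at_right_ereal filtermap_bot_iff)
    qed
    then show "(INF v\<in>{0<..v_max}. R v) \<le> R v" using v by (cases "v = 0") (auto intro: INF_lower)
  qed
qed

lemma risk_at_0_not_minimal:
  assumes "\<rho> \<noteq> 0" shows "R 0 \<noteq> min_risk"
proof -
  have f0: "f 0 = \<sigma>\<^sup>2 + \<rho>\<^sup>2 * c_tilde G 0" by (simp add: risk_quotient_def df2_def)
  have f0_nn: "0 \<le> f 0" using G.c_tilde_nonneg[of 0] by (simp add: f0)
  \<comment> \<open>The numerator of the quotient decreases at a linear rate at \<open>0\<close>, the denominator only quadratically.\<close>
  have lim: "((\<lambda>v. \<rho>\<^sup>2 * (a\<^sup>2 / (1 + v * b)) - f 0 * \<phi> * (v * b\<^sup>2)) \<longlongrightarrow> \<rho>\<^sup>2 * (a\<^sup>2 / (1 + 0 * b)) - f 0 * \<phi> * (0 * b\<^sup>2)) (at_right 0)"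
    by (intro tendsto_intros) auto
  have "0 < \<rho>\<^sup>2 * (a\<^sup>2 / (1 + 0 * b)) - f 0 * \<phi> * (0 * b\<^sup>2)" using assms H.a_pos by simp
  note order_tendstoD(1)[OF lim this]
  moreover have "\<forall>\<^sub>F v in at_right 0. 0 < v \<and> ereal v \<le> v_max"
  proof -
    have "\<exists>u>0. ereal u \<le> v_max" using v_max_pos by (cases v_max) (auto intro: exI[of _ 1])
    then obtain u where u: "0 < u" "ereal u \<le> v_max" by blast
    then show ?thesis by (intro eventually_at_rightI[of 0 u]) (auto intro: order_trans[OF _ u(2)])
  qed
  ultimately have "\<forall>\<^sub>F v in at_right 0. 0 < v \<and> ereal v \<le> v_max \<and>
      0 < \<rho>\<^sup>2 * (a\<^sup>2 / (1 + v * b)) - f 0 * \<phi> * (v * b\<^sup>2)"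
    by eventually_elim blast
  \<comment> \<open>The last inequality compares the linear gain with the quadratic loss after
    division by \<open>v\<close>; the difference tends to \<open>\<rho>\<^sup>2 * a\<^sup>2\<close>,
    so it is positive at some admissible \<open>v\<close>.\<close>
  then obtain v where v: "0 < v" "ereal v \<le> v_max" "0 < \<rho>\<^sup>2 * (a\<^sup>2 / (1 + v * b)) - f 0 * \<phi> * (v * b\<^sup>2)"
    using eventually_happens' trivial_limit_at_right_real by blast
  have "v * b / (1 + v * b) \<le> v * b" using v H.b_pos by (simp add: divide_le_eq mult_le_cancel_left1 add_pos_pos)
  then have "df2 H v \<le> v * b * (v * b)"
    using H.df2_bounds(2)[of v] H.df1_bounds(2)[of v] H.df1_pos[OF v(1)] v H.b_pos
    by (intro order_trans[OF H.df2_bounds(2)] mult_mono) auto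
  then have "f 0 * \<phi> * df2 H v \<le> f 0 * \<phi> * (v * b * (v * b))"
    using f0_nn \<phi>_pos by (intro mult_left_mono) auto
  also have "\<dots> = v * (f 0 * \<phi> * (v * b\<^sup>2))" by (simp add: power2_eq_square)
  also have "\<dots> < v * (\<rho>\<^sup>2 * (a\<^sup>2 / (1 + v * b)))" using v by (intro mult_strict_left_mono) auto
  also have "\<dots> = \<rho>\<^sup>2 * (v * a\<^sup>2 / (1 + v * b))" by simp
  also have "\<dots> \<le> \<rho>\<^sup>2 * (c_tilde G 0 - c_tilde G v)"
    using v by (intro mult_left_mono G.c_tilde_decrease) auto
  finally have "\<sigma>\<^sup>2 + \<rho>\<^sup>2 * c_tilde G v < f 0 * (1 - \<phi> * df2 H v)"
    by (simp add: f0 algebra_simps)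
  then have "f v < f 0"
    using df2_less[of v] v by (simp add: risk_quotient_def[of _ _ _ _ _ v] divide_less_eq)
  then have "R (ereal v) < R 0"
    using risk_at_real[of v] risk_at_real[of 0] v v_max_pos by (simp add: zero_ereal_def)
  moreover have "min_risk \<le> R (ereal v)" using v by (intro INF_lower) auto
  ultimately show ?thesis by auto
qed

text \<open>Without signal the numerator is the constant \<open>\<sigma>\<^sup>2\<close> while the
  denominator falls below 1 as soon as \<open>v\<close> is positive. Pure noise is thus best fitted
  by \<open>v = 0\<close>, which no penalty attains.\<close>

lemma risk_at_increasing_if_no_signal:
  assumes "\<rho> = 0" "\<sigma> \<noteq> 0" "0 < v" "v \<le> v_max"
  shows "R 0 < R v"
proof -
  have R0: "R 0 = ereal (\<sigma>\<^sup>2)"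
    using risk_at_real[of 0] v_max_pos assms by (simp add: zero_ereal_def risk_quotient_def df2_def)
  show ?thesis
  proof (cases v)
    case (real u)
    then have u: "0 < u" "ereal u \<le> v_max" using assms by auto
    have "0 < (u * a / (1 + u * a))\<^sup>2" using u H.a_pos by (intro zero_less_power divide_pos_pos add_pos_pos) auto
    also have "\<dots> \<le> df2 H u" using H.df2_bounds(1)[of u] u by simp
    finally have "0 < \<phi> * df2 H u" using \<phi>_pos by simp
    then have "\<sigma>\<^sup>2 < \<sigma>\<^sup>2 / (1 - \<phi> * df2 H u)"
      using df2_less[of u] u assms by (simp add: less_divide_eq mult_less_cancel_left1)
    then show ?thesis using R0 risk_at_real[of u] u real assms by (simp add: risk_quotient_def)
  next
    case PInf
    then have "\<phi> \<le> 1" using assms v_max_infinite by simp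
    then have "ereal (\<sigma>\<^sup>2) < R \<infinity>"
      unfolding risk_at_infinity[OF \<open>\<phi> \<le> 1\<close>]
      using assms \<phi>_pos by (simp add: less_divide_eq mult_less_cancel_left1)
    then show ?thesis using PInf R0 by simp
  qed (use assms in auto)
qed

section \<open>Fixed points reached by each family of parameters\<close>

lemma v_fix_nonneg: "0 \<le> l \<Longrightarrow> ereal \<phi> \<le> \<phi>s \<Longrightarrow> 0 \<le> v_fix H l \<phi>s"
  using H.v_fix_pos[of l "real_of_ereal \<phi>s"] \<phi>_pos
  by (cases \<phi>s) (auto simp: H.v_fix_infinity less_imp_le)

lemma v_fix_mem: "0 \<le> l \<Longrightarrow> ereal \<phi> \<le> \<phi>s \<Longrightarrow> v_fix H l \<phi>s \<in> {0..v_max}"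
  using v_fix_nonneg H.v_fix_le \<phi>_pos by simp

lemma v_fix_image_subsample: "v_fix H 0 ` {ereal \<phi>..} = {0..v_max}"
proof
  show "{0..v_max} \<subseteq> v_fix H 0 ` {ereal \<phi>..}"
  proof
    fix v assume "v \<in> {0..v_max}"
    then obtain \<phi>s where "ereal \<phi> \<le> \<phi>s" "v_fix H 0 \<phi>s = v" using H.v_fix_subsample_onto \<phi>_pos by auto
    then show "v \<in> v_fix H 0 ` {ereal \<phi>..}" by force
  qed
qed (use v_fix_mem in blast)

lemma v_fix_image_penalty: "(\<lambda>l. v_fix H l (ereal \<phi>)) ` {0..} = {0<..v_max}"
proof
  show "{0<..v_max} \<subseteq> (\<lambda>l. v_fix H l (ereal \<phi>)) ` {0..}"
  proof
    fix v assume "v \<in> {0<..v_max}"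
    then obtain l where "0 \<le> l" "v_fix H l (ereal \<phi>) = v" using H.v_fix_penalty_onto \<phi>_pos by auto
    then show "v \<in> (\<lambda>l. v_fix H l (ereal \<phi>)) ` {0..}" by force
  qed
qed (use H.v_fix_pos \<phi>_pos v_fix_mem in auto)

lemma v_fix_image_joint: "(\<lambda>(l, \<phi>s). v_fix H l \<phi>s) ` ({0..} \<times> {ereal \<phi>..}) = {0..v_max}"
proof
  show "{0..v_max} \<subseteq> (\<lambda>(l, \<phi>s). v_fix H l \<phi>s) ` ({0..} \<times> {ereal \<phi>..})"
    unfolding v_fix_image_subsample[symmetric] by force
qed (use v_fix_mem in auto)

lemma INF_subsample: "(INF \<phi>s\<in>{ereal \<phi>..}. risk H G \<rho> \<sigma> 0 \<phi> \<phi>s) = min_risk"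
  unfolding risk_eq_risk_at v_fix_image_subsample[symmetric] image_image ..

lemma INF_penalty: "(INF l\<in>{0..}. risk H G \<rho> \<sigma> l \<phi> (ereal \<phi>)) = min_risk"
  unfolding INF_positive[symmetric] v_fix_image_penalty[symmetric] risk_eq_risk_at image_image ..

lemma min_joint_risk_eq: "min_joint_risk H G \<rho> \<sigma> \<phi> = min_risk"
  unfolding min_joint_risk_def v_fix_image_joint[symmetric] risk_eq_risk_at image_image
  by (simp add: case_prod_unfold)

section \<open>Optimal parameters and the optimal path\<close>

lemma opt_subsample_iff:
  "opt_subsample H G \<rho> \<sigma> \<phi> \<phi>s \<longleftrightarrow> ereal \<phi> \<le> \<phi>s \<and> R (v_fix H 0 \<phi>s) = min_risk"
  unfolding opt_subsample_def is_arg_min_iff_eq_INF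
  using INF_subsample by (simp add: atLeast_def risk_eq_risk_at)

lemma opt_penalty_iff:
  "opt_penalty H G \<rho> \<sigma> \<phi> l \<longleftrightarrow> 0 \<le> l \<and> R (v_fix H l (ereal \<phi>)) = min_risk"
  unfolding opt_penalty_def is_arg_min_iff_eq_INF
  using INF_penalty by (simp add: atLeast_def risk_eq_risk_at)

lemma opt_joint_iff:
  "opt_joint H G \<rho> \<sigma> \<phi> (l, \<phi>s) \<longleftrightarrow> 0 \<le> l \<and> ereal \<phi> \<le> \<phi>s \<and> R (v_fix H l \<phi>s) = min_risk"
proof -
  have eq: "Collect (\<lambda>(l, \<phi>s). 0 \<le> l \<and> ereal \<phi> \<le> \<phi>s) = {0..} \<times> {ereal \<phi>..}" by auto
  then show ?thesis
    unfolding opt_joint_def is_arg_min_iff_eq_INF eq min_joint_risk_eq[unfolded min_joint_risk_def]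
    by (simp add: risk_eq_risk_at)
qed

lemma optimal_pathI:
  assumes ls: "opt_penalty H G \<rho> \<sigma> \<phi> ls" and "ereal \<phi> \<le> \<phi>s"
    and eq: "ls = 0 \<or> v_fix H ls (ereal \<phi>) = v_fix H 0 \<phi>s"
  shows "optimal_path H G \<rho> \<sigma> \<phi> ls \<phi>s"
  unfolding optimal_path_def min_joint_risk_eq risk_eq_risk_at
proof
  fix \<theta> assume \<theta>: "\<theta> \<in> {0..ls}"
  show "R (v_fix H (ls - \<theta>) (ereal \<phi> + ereal (\<theta> / ls) * (\<phi>s - ereal \<phi>))) = min_risk"
  proof (cases "ls = 0")
    case True
    \<comment> \<open>Here \<open>\<theta> / ls = 0\<close>, and \<open>0 * \<infinity> = 0\<close>
      in \<open>ereal\<close>, so the pair is \<open>(0, \<phi>)\<close> even for an infinite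
      subsample ratio.\<close>
    then show ?thesis using \<theta> ls by (simp add: opt_penalty_iff zero_ereal_def[symmetric])
  next
    case False
    then have "v_fix H (ls - \<theta>) (ereal \<phi> + ereal (\<theta> / ls) * (\<phi>s - ereal \<phi>)) = v_fix H ls (ereal \<phi>)"
      using assms \<theta> \<phi>_pos by (subst H.v_fix_path) (auto simp: opt_penalty_iff)
    then show ?thesis using ls by (simp add: opt_penalty_iff)
  qed
qed

text \<open>If 0 is not an optimal value, an optimal subsample ratio has a positive fixed point, and
  some penalty reproduces it.\<close>

lemma opt_penalty_if_opt_subsample:
  assumes "opt_subsample H G \<rho> \<sigma> \<phi> \<phi>s" "R 0 \<noteq> min_risk"
  obtains l where "opt_penalty H G \<rho> \<sigma> \<phi> l" "v_fix H l (ereal \<phi>) = v_fix H 0 \<phi>s"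
proof -
  have "v_fix H 0 \<phi>s \<noteq> 0" using assms by (auto simp: opt_subsample_iff)
  then have "0 < v_fix H 0 \<phi>s" "v_fix H 0 \<phi>s \<le> v_max"
    using assms v_fix_mem[of 0 \<phi>s] by (auto simp: opt_subsample_iff order_less_le)
  then obtain l where "0 \<le> l" "v_fix H l (ereal \<phi>) = v_fix H 0 \<phi>s"
    using H.v_fix_penalty_onto \<phi>_pos by metis
  then show thesis using that[of l] assms by (simp add: opt_subsample_iff opt_penalty_iff)
qed

lemma opt_subsample_if_opt_penalty:
  assumes "opt_penalty H G \<rho> \<sigma> \<phi> l"
  obtains \<phi>s where "opt_subsample H G \<rho> \<sigma> \<phi> \<phi>s" "v_fix H l (ereal \<phi>) = v_fix H 0 \<phi>s"
proof -
  have "v_fix H l (ereal \<phi>) \<in> v_fix H 0 ` {ereal \<phi>..}"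
    using assms v_fix_mem by (simp add: v_fix_image_subsample opt_penalty_iff)
  then obtain \<phi>s where "ereal \<phi> \<le> \<phi>s" "v_fix H l (ereal \<phi>) = v_fix H 0 \<phi>s" by auto
  then show thesis using that[of \<phi>s] assms by (simp add: opt_subsample_iff opt_penalty_iff)
qed

lemma opt_subsample_exists: "\<exists>\<phi>s. opt_subsample H G \<rho> \<sigma> \<phi> \<phi>s"
proof -
  obtain v where v: "v \<in> {0..v_max}" "R v = min_risk" using min_risk_attained by blast
  from v(1) obtain \<phi>s where "ereal \<phi> \<le> \<phi>s" "v = v_fix H 0 \<phi>s"
    unfolding v_fix_image_subsample[symmetric] by auto
  then show ?thesis using v(2) by (auto simp: opt_subsample_iff)
qed

lemma opt_joint_exists: "\<exists>q. opt_joint H G \<rho> \<sigma> \<phi> q"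
proof -
  obtain \<phi>s where "opt_subsample H G \<rho> \<sigma> \<phi> \<phi>s" using opt_subsample_exists by blast
  then have "opt_joint H G \<rho> \<sigma> \<phi> (0, \<phi>s)" by (simp add: opt_joint_iff opt_subsample_iff)
  then show ?thesis ..
qed

text \<open>Each optimal parameter has a counterpart in the other problem with the same fixed point;
  uniqueness in either problem identifies a counterpart with the given parameter, so both endpoints
  share \<open>v\<close>.\<close>

lemma optimal_path_if_unique:
  assumes ls: "opt_penalty H G \<rho> \<sigma> \<phi> ls" and \<phi>ss: "opt_subsample H G \<rho> \<sigma> \<phi> \<phi>ss"
    and uniq: "(\<exists>!l. opt_penalty H G \<rho> \<sigma> \<phi> l) \<or> (\<exists>!\<phi>s. opt_subsample H G \<rho> \<sigma> \<phi> \<phi>s)"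
  shows "optimal_path H G \<rho> \<sigma> \<phi> ls \<phi>ss"
proof (cases "R 0 = min_risk")
  case True
  \<comment> \<open>An optimal penalty has a positive fixed point. If \<open>v = 0\<close> is
    optimal as well, signal and noise must both vanish, and the risk is identically 0.\<close>
  have "0 < v_fix H ls (ereal \<phi>)" "v_fix H ls (ereal \<phi>) \<le> v_max"
    using ls H.v_fix_pos[of ls \<phi>] v_fix_mem[of ls \<phi>] \<phi>_pos by (auto simp: opt_penalty_iff)
  moreover have "R 0 = R (v_fix H ls (ereal \<phi>))" using True ls by (simp add: opt_penalty_iff)
  moreover have "\<rho> = 0" using True risk_at_0_not_minimal by blast
  ultimately have "\<sigma> = 0" using risk_at_increasing_if_no_signal by (metis less_irrefl)
  with \<open>\<rho> = 0\<close> have "R v = 0" for v by (simp add: risk_at_zero_params)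
  moreover from this have "min_risk = 0" using min_risk_attained by metis
  ultimately show ?thesis by (simp add: optimal_path_def min_joint_risk_eq risk_eq_risk_at)
next
  case False
  obtain l where l: "opt_penalty H G \<rho> \<sigma> \<phi> l" "v_fix H l (ereal \<phi>) = v_fix H 0 \<phi>ss"
    using \<phi>ss False by (rule opt_penalty_if_opt_subsample)
  obtain \<phi>s where \<phi>s: "opt_subsample H G \<rho> \<sigma> \<phi> \<phi>s" "v_fix H ls (ereal \<phi>) = v_fix H 0 \<phi>s"
    using ls by (rule opt_subsample_if_opt_penalty)
  have "v_fix H ls (ereal \<phi>) = v_fix H 0 \<phi>ss" using uniq ls \<phi>ss l \<phi>s by metis
  then show ?thesis using ls \<phi>ss by (intro optimal_pathI) (auto simp: opt_subsample_iff)
qed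

lemma optimal_path_from_penalty:
  assumes "opt_penalty H G \<rho> \<sigma> \<phi> ls"
  shows "\<exists>\<phi>ss. opt_subsample H G \<rho> \<sigma> \<phi> \<phi>ss \<and> optimal_path H G \<rho> \<sigma> \<phi> ls \<phi>ss"
  using assms by (metis opt_subsample_if_opt_penalty optimal_pathI opt_subsample_iff)

lemma optimal_path_from_subsample:
  assumes "\<rho> \<noteq> 0" "opt_subsample H G \<rho> \<sigma> \<phi> \<phi>ss"
  shows "\<exists>ls. opt_penalty H G \<rho> \<sigma> \<phi> ls \<and> optimal_path H G \<rho> \<sigma> \<phi> ls \<phi>ss"
  using assms risk_at_0_not_minimal
  by (metis opt_penalty_if_opt_subsample optimal_pathI opt_subsample_iff)

lemma opt_penalty_exists: "\<rho> \<noteq> 0 \<Longrightarrow> \<exists>ls. opt_penalty H G \<rho> \<sigma> \<phi> ls"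
  using opt_subsample_exists optimal_path_from_subsample by blast

end

text \<open>The uniform eigenvalue bounds pass to the supports of both limit laws: the
  finite-dimensional distribution functions vanish below \<open>a\<close> and are constant from
  \<open>b\<close> on. One pair \<open>a\<close>, \<open>b\<close> serves every \<phi>.\<close>

lemma risk_limits_of_models:
  fixes Sigma :: "nat \<Rightarrow> nat \<Rightarrow> nat \<Rightarrow> real"
  assumes "feature_model M n p X Z Sigma r w H" "response_model M n p X y eps beta r w G \<rho> \<sigma>"
  obtains a b where "\<And>\<phi>. 0 < \<phi> \<Longrightarrow> risk_limits H G a b \<phi>"
proof -
  interpret F: feature_model M n p X Z Sigma r w H by fact
  interpret E: response_model M n p X y eps beta r w G \<rho> \<sigma> by fact
  obtain a b where a: "0 < a" and r: "\<And>m k. k < p m \<Longrightarrow> a \<le> r m k \<and> r m k \<le> b"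
    using F.eigenvalue_bounds by blast
  have low: "\<not> r m i \<le> x" if "x < a" "i < p m" for m i x
    using r[OF that(2)] that by auto
  have high: "r m i \<le> x" if "b \<le> x" "i < p m" for m i x
    using r[OF that(2)] that by auto
  have "AE x in H. a \<le> x \<and> x \<le> b"
  proof (rule weak_conv_support[OF F.H_distribution F.H_limit])
    show "spectral_cdf (p m) (r m) x = 0" if "x < a" for m x
      unfolding spectral_cdf_def using that by (subst sum.neutral) (auto simp: low)
    show "spectral_cdf (p m) (r m) x = spectral_cdf (p m) (r m) b" if "b \<le> x" for m x
      unfolding spectral_cdf_def using that
      by (intro arg_cong2[where f = "(/)"] sum.cong refl) (simp add: high)
  qed
  moreover have "AE x in G. a \<le> x \<and> x \<le> b"
  proof (rule weak_conv_support[OF E.G_distribution E.G_limit])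
    show "signal_cdf (p m) (r m) (w m) (beta m) x = 0" if "x < a" for m x
      unfolding signal_cdf_def using that by (subst sum.neutral) (auto simp: low)
    show "signal_cdf (p m) (r m) (w m) (beta m) x = signal_cdf (p m) (r m) (w m) (beta m) b" if "b \<le> x" for m x
      unfolding signal_cdf_def using that
      by (intro arg_cong2[where f = "(/)"] sum.cong refl) (simp add: high)
  qed
  ultimately have "positive_bounded_law H a b" "positive_bounded_law G a b"
    using a F.H_distribution E.G_distribution
    by (simp_all add: positive_bounded_law_def positive_bounded_law_axioms_def)
  then show thesis using that[of a b] by (simp add: risk_limits_def risk_limits_axioms_def)
qed

text \<open>A minimum is stated as an infimum together with the existence of a minimizer. For the
  penalty this takes \<open>\<rho> \<noteq> 0\<close>, since with noise but no signal the infimum is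
  approached only as the penalty grows. The path is stated for given minimizers when one of them is
  unique, and otherwise for suitably matched ones.\<close>

theorem theorem2p3:
  fixes M :: "'a measure" and n p :: "nat \<Rightarrow> nat"
    and X Z :: "nat \<Rightarrow> 'a \<Rightarrow> nat \<Rightarrow> nat \<Rightarrow> real"
    and y eps :: "nat \<Rightarrow> 'a \<Rightarrow> nat \<Rightarrow> real"
    and Sigma w :: "nat \<Rightarrow> nat \<Rightarrow> nat \<Rightarrow> real"
    and r beta :: "nat \<Rightarrow> nat \<Rightarrow> real"
    and H G :: "real measure" and \<rho> \<sigma> :: real
  assumes "iid_data M n p X y"
    and "feature_model M n p X Z Sigma r w H"
    and "response_model M n p X y eps beta r w G \<rho> \<sigma>"
  shows "\<forall>\<phi>>0.
      (INF \<phi>s\<in>{ereal \<phi>..}. risk H G \<rho> \<sigma> 0 \<phi> \<phi>s) = (INF l\<in>{0..}. risk H G \<rho> \<sigma> l \<phi> (ereal \<phi>)) \<and>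
      (INF l\<in>{0..}. risk H G \<rho> \<sigma> l \<phi> (ereal \<phi>)) = min_joint_risk H G \<rho> \<sigma> \<phi> \<and>
      (\<exists>\<phi>ss. opt_subsample H G \<rho> \<sigma> \<phi> \<phi>ss) \<and>
      (\<rho> \<noteq> 0 \<longrightarrow> (\<exists>ls. opt_penalty H G \<rho> \<sigma> \<phi> ls)) \<and>
      (\<exists>q. opt_joint H G \<rho> \<sigma> \<phi> q) \<and>
      (\<forall>ls \<phi>ss. opt_penalty H G \<rho> \<sigma> \<phi> ls \<and> opt_subsample H G \<rho> \<sigma> \<phi> \<phi>ss \<and>
         ((\<exists>!l. opt_penalty H G \<rho> \<sigma> \<phi> l) \<or> (\<exists>!\<phi>s. opt_subsample H G \<rho> \<sigma> \<phi> \<phi>s))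
         \<longrightarrow> optimal_path H G \<rho> \<sigma> \<phi> ls \<phi>ss) \<and>
      (\<forall>ls. opt_penalty H G \<rho> \<sigma> \<phi> ls \<longrightarrow>
         (\<exists>\<phi>ss. opt_subsample H G \<rho> \<sigma> \<phi> \<phi>ss \<and> optimal_path H G \<rho> \<sigma> \<phi> ls \<phi>ss)) \<and>
      (\<rho> \<noteq> 0 \<longrightarrow> (\<forall>\<phi>ss. opt_subsample H G \<rho> \<sigma> \<phi> \<phi>ss \<longrightarrow>
         (\<exists>ls. opt_penalty H G \<rho> \<sigma> \<phi> ls \<and> optimal_path H G \<rho> \<sigma> \<phi> ls \<phi>ss)))"
proof -
  obtain a b where limits: "\<And>\<phi>. 0 < \<phi> \<Longrightarrow> risk_limits H G a b \<phi>"
    using assms(2,3) by (rule risk_limits_of_models) blast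
  show ?thesis
  proof (intro allI impI, goal_cases)
    case (1 \<phi>)
    then interpret risk_limits H G a b \<rho> \<sigma> \<phi> by (rule limits)
    show ?case
      unfolding INF_subsample INF_penalty min_joint_risk_eq
      by (intro conjI allI impI refl opt_subsample_exists opt_penalty_exists opt_joint_exists
          optimal_path_from_penalty optimal_path_from_subsample;
          (assumption | elim conjE, rule optimal_path_if_unique, assumption+))
  qed
qed

end
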